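(* Let $p$ be a prime of $\mathbb{Z}$. Let $F\in\mathbb{Q}[x]$ be the polynomial constructed in the context for $V=\mathbb{Z}_{(p)}$ and $n=2$. Then $F$ is optimal; that is, $F$ is properly integral over $\mathrm{Int}_{\mathbb{Q}}(M_2(\mathbb{Z}_{(p)}))$ and has minimal degree among all polynomials in $\mathbb{Q}[x]$ that are properly integral over $\mathrm{Int}_{\mathbb{Q}}(M_2(\mathbb{Z}_{(p)}))$.
   Context: $\mathbb{Z}_{(p)}$ is the localization of $\mathbb{Z}$ at $p$, and $\mathrm{Int}_{\mathbb{Q}}(M_2(\mathbb{Z}_{(p)}))=\{f\in\mathbb{Q}[x]\mid f(M_2(\mathbb{Z}_{(p)}))\subseteq M_2(\mathbb{Z}_{(p)})\}$. A polynomial $f\in\mathbb{Q}[x]$ is properly integral over this ring if it lies in the integral closure of the ring (in its fraction field $\mathbb{Q}(x)$) but not in the ring itself. A properly integral polynomial is optimal if it has minimal degree among all properly integral polynomials over the ring. Construction of $F$ (case $n=2$, $V=\mathbb{Z}_{(p)}$, $\pi V=p\mathbb{Z}_{(p)}$, $q=p$). Fix a representative in $\mathbb{Z}_{(p)}$ for each element of $\mathbb{F}_p$; write $\mathbb{F}_p$ also for this set of representatives and $\mathbb{F}_p^\times$ for the representatives of the nonzero classes. Let $\mathscr{P}$ be the set of monic irreducible polynomials of degree $2$ in $\mathbb{F}_p[x]$; for each of them fix a monic lift of degree $2$ in $\mathbb{Z}_{(p)}[x]$, denoted by the same symbol. Put $$\theta(x)=\prod_{f\in\mathscr{P}}f(x),\quad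 h(x)=x\prod_{a\in\mathbb{F}_p^\times}(x^2+\pi a),\quad H(x)=\prod_{b\in\mathbb{F}_p}h(x-b),\quad F(x)=\frac{H(x)\,\theta(x)^p}{\pi^p},$$ where $\pi$ is a generator of $p\mathbb{Z}_{(p)}$ (e.g. $\pi=p$). *)

theory Defs
  imports
    "HOL-Analysis.Determinants"
    "HOL-Computational_Algebra.Polynomial_Factorial"
    "Berlekamp_Zassenhaus.Finite_Field"
begin

definition Z_loc :: "nat \<Rightarrow> rat set" where
  "Z_loc p = {of_int a / of_int b | a b. \<not> int p dvd b}"

subsection \<open>The residue field\<close>

text \<open>
  The field with \<open>p\<close> elements is the type \<open>'p mod_ring\<close>, where \<open>CARD('p) = p\<close> is prime.
  The reduction map sends a fraction in lowest terms to the quotient of the classes of its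
  numerator and denominator; it is meant to be applied only to elements of \<open>Z_loc CARD('p)\<close>,
  where that denominator is invertible modulo \<open>p\<close>.
\<close>

definition red :: "rat \<Rightarrow> 'p::prime_card mod_ring" where
  "red x = (case quotient_of x of (a, b) \<Rightarrow> of_int a / of_int b)"

lemma of_int_mod_ring_eq_0_iff:
  "(of_int b :: 'p::prime_card mod_ring) = 0 \<longleftrightarrow> int CARD('p) dvd b"
  using of_int_eq_iff_cong_CHAR[of b 0, where 'a = "'p mod_ring"] by (simp add: cong_0_iff)

lemma red_divide:
  assumes "\<not> int CARD('p) dvd b"
  shows "red (of_int a / of_int b) = (of_int a / of_int b :: 'p::prime_card mod_ring)"
proof -
  obtain c d where q: "quotient_of (of_int a / of_int b) = (c, d)"
    by fastforce
  have d: "d > 0" and eq: "of_int a / of_int b = (of_int c / of_int d :: rat)"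
    and cop: "coprime c d"
    using quotient_of_denom_pos[OF q] quotient_of_div[OF q] quotient_of_coprime[OF q] by auto
  have b: "b \<noteq> 0"
    using assms by auto
  have "(of_int (a * d) :: rat) = of_int (c * b)"
    using eq b d by (simp add: field_simps)
  then have ad: "a * d = c * b"
    by (simp only: of_int_eq_iff)
  then have "d dvd b"
    using cop by (metis coprime_commute coprime_dvd_mult_right_iff dvd_triv_right)
  then have "\<not> int CARD('p) dvd d"
    using assms dvd_trans by blast
  then have "(of_int d :: 'p mod_ring) \<noteq> 0" "(of_int b :: 'p mod_ring) \<noteq> 0"
    using assms by (simp_all add: of_int_mod_ring_eq_0_iff)
  moreover have "(of_int a * of_int d :: 'p mod_ring) = of_int c * of_int b"
    using ad by (metis of_int_mult)
  ultimately show ?thesis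
    by (simp add: red_def q field_simps)
qed

subsection \<open>Integer-valued polynomials on matrices\<close>

text \<open>
  The operators \<open>*\<close> and \<open>^\<close> on vector and matrix types are not the matrix product and
  power, hence the definitions below in terms of \<open>**\<close>; \<open>mat c\<close> is the scalar matrix.
\<close>

primrec matrix_power :: "'a::semiring_1^'n^'n \<Rightarrow> nat \<Rightarrow> 'a^'n^'n" where
  "matrix_power A 0 = mat 1"
| "matrix_power A (Suc k) = A ** matrix_power A k"

definition matrix_poly :: "'a::comm_semiring_1 poly \<Rightarrow> 'a^'n^'n \<Rightarrow> 'a^'n^'n" where
  "matrix_poly f A = (\<Sum>k\<le>degree f. mat (coeff f k) ** matrix_power A k)"

definition M2 :: "'a set \<Rightarrow> ('a^2^2) set" where
  "M2 R = {A. \<forall>i j. A $ i $ j \<in> R}"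

definition Int_M2 :: "nat \<Rightarrow> rat poly set" where
  "Int_M2 p = {f. matrix_poly f ` M2 (Z_loc p) \<subseteq> M2 (Z_loc p)}"

subsection \<open>Properly integral and optimal polynomials\<close>

definition integral_closure_of :: "'a::comm_ring_1 set \<Rightarrow> 'a set" where
  "integral_closure_of R =
     {y. \<exists>P. lead_coeff P = 1 \<and> (\<forall>i. coeff P i \<in> R) \<and> poly P y = 0}"

text \<open>
  Rings between \<open>Z_loc p [x]\<close> and \<open>\<rat>[x]\<close>, such as \<open>Int_M2 p\<close>, have the field of rational
  functions \<open>\<rat>(x)\<close>, here the type \<open>rat poly fract\<close>, as their fraction field.
\<close>

definition properly_integral :: "rat poly set \<Rightarrow> rat poly \<Rightarrow> bool" where
  "properly_integral R f \<longleftrightarrow> to_fract f \<in> integral_closure_of (to_fract ` R) \<and> f \<notin> R"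

definition optimal :: "rat poly set \<Rightarrow> rat poly \<Rightarrow> bool" where
  "optimal R f \<longleftrightarrow>
     properly_integral R f \<and> (\<forall>g. properly_integral R g \<longrightarrow> degree f \<le> degree g)"

subsection \<open>The construction\<close>

definition residue_representatives :: "('p::prime_card mod_ring \<Rightarrow> rat) \<Rightarrow> bool" where
  "residue_representatives rep \<longleftrightarrow> (\<forall>a. rep a \<in> Z_loc CARD('p) \<and> red (rep a) = a)"

definition monic_irred2 :: "'p::prime_card mod_ring poly set" where
  "monic_irred2 = {f. lead_coeff f = 1 \<and> irreducible f \<and> degree f = 2}"

lemma finite_monic_irred2: "finite (monic_irred2 :: 'p::prime_card mod_ring poly set)"
proof (rule finite_subset)
  show "monic_irred2 \<subseteq> (\<lambda>(a, b, c). [:a, b, c:]) ` (UNIV :: ('p mod_ring \<times> 'p mod_ring \<times> 'p mod_ring) set)"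
  proof
    fix f :: "'p mod_ring poly"
    assume "f \<in> monic_irred2"
    then have "degree f = 2"
      by (simp add: monic_irred2_def)
    then have "f = [:coeff f 0, coeff f 1, coeff f 2:]"
      by (intro poly_eqI)
        (auto simp: coeff_pCons numeral_2_eq_2 coeff_eq_0 split: nat.splits)
    then show "f \<in> (\<lambda>(a, b, c). [:a, b, c:]) ` UNIV"
      by (metis (mono_tags, lifting) UNIV_I case_prod_conv image_eqI)
  qed
qed simp

definition monic_lifts :: "('p::prime_card mod_ring poly \<Rightarrow> rat poly) \<Rightarrow> bool" where
  "monic_lifts lift \<longleftrightarrow>
     (\<forall>f\<in>monic_irred2. lead_coeff (lift f) = 1 \<and> degree (lift f) = 2 \<and>
        (\<forall>i. coeff (lift f) i \<in> Z_loc CARD('p)) \<and> map_poly red (lift f) = f)"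

definition theta_poly :: "('p::prime_card mod_ring poly \<Rightarrow> rat poly) \<Rightarrow> rat poly" where
  "theta_poly lift = (\<Prod>f\<in>monic_irred2. lift f)"

definition h_poly :: "rat \<Rightarrow> ('p::prime_card mod_ring \<Rightarrow> rat) \<Rightarrow> rat poly" where
  "h_poly \<pi> rep = [:0, 1:] * (\<Prod>a\<in>UNIV - {0}. [:\<pi> * rep a, 0, 1:])"

definition H_poly :: "rat \<Rightarrow> ('p::prime_card mod_ring \<Rightarrow> rat) \<Rightarrow> rat poly" where
  "H_poly \<pi> rep = (\<Prod>b\<in>UNIV. pcompose (h_poly \<pi> rep) [:- rep b, 1:])"

definition F_poly ::
  "rat \<Rightarrow> ('p::prime_card mod_ring \<Rightarrow> rat) \<Rightarrow> ('p mod_ring poly \<Rightarrow> rat poly) \<Rightarrow> rat poly" where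
  "F_poly \<pi> rep lift =
     smult (1 / \<pi> ^ CARD('p)) (H_poly \<pi> rep * theta_poly lift ^ CARD('p))"

end

theory Submission
  imports Defs
begin

text \<open>
  Write \<open>V\<close> for \<open>Z_loc p\<close>. A polynomial over \<open>\<rat>\<close> is integer-valued on the matrices over \<open>V\<close> if
  and only if its remainder modulo each monic quadratic \<open>m\<close> over \<open>V\<close> has coefficients in \<open>V\<close>
  (\<open>Int_M2_iff\<close>). So the matrices disappear, and the question becomes one about the quadratic
  algebras \<open>\<rat>[X] / (m)\<close>. Integrality over the ring is visible there too: it holds if, modulo
  every \<open>m\<close>, the polynomial satisfies a monic quadratic equation over \<open>V\<close>
  (\<open>quadratic_imp_integral\<close>), and it forces all norms to lie in \<open>V\<close>
  (\<open>integral_imp_quad_norm_in_V\<close>).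

  Why \<open>F\<close> is properly integral: modulo every \<open>m\<close>, \<open>F\<close> lies in a ring \<open>V + V \<gamma>\<close>. If the reduction
  of \<open>m\<close> is irreducible, each of the \<open>p\<close> factors \<open>\<theta>\<close> is divisible by \<open>p\<close> in \<open>V[X] / (m)\<close>; if it
  has two distinct roots, the factors of \<open>H\<close> that belong to them yield \<open>p ^ p\<close>; and if it has a
  double root \<open>a\<close>, the factor \<open>h(x - a)\<close> does, except that for \<open>m(a)\<close> divisible by \<open>p\<^sup>2\<close> one has
  to pass to the larger ring generated by \<open>\<gamma> = (x - a) / p\<close>. In this exceptional case, \<open>F\<close> need
  not be in \<open>V[X]\<close> modulo \<open>m\<close>, and \<open>m = (x - a)\<^sup>2\<close> shows that \<open>F\<close> is not integer-valued
  (\<open>F_notin_Int\<close>).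

  Why nothing smaller is properly integral: let \<open>Phi\<close> be the product of \<open>\<theta>\<close> and all \<open>(x - a)\<^sup>2\<close>.
  Then \<open>Phi / p\<close> is integer-valued, and \<open>deg F = p deg Phi - p\<close>. A polynomial \<open>g\<close> of smaller
  degree has an expansion with \<open>p\<close> digits in base \<open>Phi\<close>, and it is enough to show that \<open>p ^ k\<close>
  times the \<open>k\<close>-th digit has coefficients in \<open>V\<close>. If this needs an additional power \<open>p ^ N\<close> with
  \<open>N > 0\<close>, let \<open>S k\<close> be the scaled digits, so that \<open>p ^ N g\<close> is the sum of the
  \<open>S k (Phi / p) ^ k\<close>. For a divisor \<open>L\<close> of \<open>Phi = L \<Psi>\<close> and a residue \<open>c\<close>, modulo \<open>m = L + p c\<close>
  this is the sum of the \<open>S k (- c \<Psi>) ^ k\<close>. If \<open>g\<close> is integral, the norm of this sum is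
  divisible by \<open>p\<^sup>2\<close>. When \<open>m\<close> has no root modulo \<open>p\<^sup>2\<close>, the sum itself is then divisible by \<open>p\<close>
  modulo \<open>m\<close>. Since the reduction of \<open>m\<close> does not depend on \<open>c\<close>, having as many \<open>c\<close> as digits
  separates the digits (\<open>dvd_coefficients_of_vandermonde\<close>) and makes each of them divisible by
  \<open>L\<close> modulo \<open>p\<close>. All \<open>p\<close> residues \<open>c\<close> are admissible when \<open>L\<close> is a factor of \<open>\<theta>\<close>, but only the
  \<open>p - 1\<close> residues other than \<open>0\<close> when \<open>L = (x - a)\<^sup>2\<close>. There the residue \<open>0\<close> still gives
  divisibility by \<open>x - a\<close>, which is enough for the leading digit to vanish modulo \<open>p\<close>, because
  its degree is smaller by \<open>p\<close>; and then only \<open>p - 1\<close> digits are left to separate. So every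
  \<open>S k\<close> has too many divisors modulo \<open>p\<close> for its degree and vanishes there (\<open>residues_vanish\<close>),
  and \<open>N\<close> can be lowered. The bound on the degree of \<open>g\<close> is exactly what this argument needs.
\<close>

section \<open>The discrete valuation ring\<close>

locale localization =
  fixes p :: nat
  assumes prime_p: "prime p"
begin

abbreviation V :: "rat set" where "V \<equiv> Z_loc p"

lemma p_pos: "0 < p" and p_ge2: "2 \<le> p"
  using prime_p prime_ge_2_nat[of p] by auto

lemma prime_int_p: "prime (int p)"
  using prime_p by simp

lemma VI: "\<not> int p dvd b \<Longrightarrow> of_int a / of_int b \<in> V"
  by (auto simp: Z_loc_def)

lemma VE:
  assumes "x \<in> V"
  obtains a b where "\<not> int p dvd b" "x = of_int a / of_int b" "b \<noteq> 0"
  using assms by (auto simp: Z_loc_def)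

lemma V_of_int [simp, intro]: "of_int a \<in> V"
proof -
  have "\<not> int p dvd 1" using prime_int_p by (metis not_prime_unit)
  from VI[OF this, of a] show ?thesis by simp
qed

lemma V_0 [simp, intro]: "0 \<in> V" and V_1 [simp, intro]: "1 \<in> V"
  using V_of_int[of 0] V_of_int[of 1] by simp_all

lemma V_of_nat [simp, intro]: "of_nat a \<in> V"
  using V_of_int[of "int a"] by simp

lemma V_numeral [simp, intro]: "numeral a \<in> V"
  using V_of_int[of "numeral a"] by simp

lemma V_add [simp, intro]: assumes "x \<in> V" "y \<in> V" shows "x + y \<in> V"
proof -
  obtain a b where ab: "\<not> int p dvd b" "x = of_int a / of_int b" "b \<noteq> 0" using VE[OF assms(1)] .
  obtain c d where cd: "\<not> int p dvd d" "y = of_int c / of_int d" "d \<noteq> 0" using VE[OF assms(2)] .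
  have "\<not> int p dvd b * d" using ab cd prime_int_p by (simp add: prime_dvd_mult_iff)
  moreover have "x + y = of_int (a * d + c * b) / of_int (b * d)"
    using ab cd by (simp add: field_simps)
  ultimately show ?thesis by (metis VI)
qed

lemma V_mult [simp, intro]: assumes "x \<in> V" "y \<in> V" shows "x * y \<in> V"
proof -
  obtain a b where ab: "\<not> int p dvd b" "x = of_int a / of_int b" "b \<noteq> 0" using VE[OF assms(1)] .
  obtain c d where cd: "\<not> int p dvd d" "y = of_int c / of_int d" "d \<noteq> 0" using VE[OF assms(2)] .
  have "\<not> int p dvd b * d" using ab cd prime_int_p by (simp add: prime_dvd_mult_iff)
  moreover have "x * y = of_int (a * c) / of_int (b * d)"
    using ab cd by (simp add: field_simps)
  ultimately show ?thesis by (metis VI)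
qed

lemma V_uminus [simp, intro]: "x \<in> V \<Longrightarrow> - x \<in> V"
  using V_mult[OF V_of_int[of "-1"], of x] by simp

lemma V_diff [simp, intro]: "x \<in> V \<Longrightarrow> y \<in> V \<Longrightarrow> x - y \<in> V"
  using V_add[of x "- y"] by simp

lemma V_power [simp, intro]: "x \<in> V \<Longrightarrow> x ^ n \<in> V"
  by (induction n) auto

lemma V_sum [intro]: "(\<And>i. i \<in> I \<Longrightarrow> f i \<in> V) \<Longrightarrow> sum f I \<in> V"
  by (induction I rule: infinite_finite_induct) auto

lemma V_prod [intro]: "(\<And>i. i \<in> I \<Longrightarrow> f i \<in> V) \<Longrightarrow> prod f I \<in> V"
  by (induction I rule: infinite_finite_induct) auto

lemma inverse_p_notin_V: "1 / of_nat p \<notin> V"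
proof
  assume "1 / of_nat p \<in> V"
  then obtain a b where ab: "\<not> int p dvd b" "1 / of_nat p = (of_int a / of_int b :: rat)" "b \<noteq> 0"
    by (rule VE)
  then have "(of_int b :: rat) = of_int (int p * a)"
    using p_pos by (simp add: field_simps)
  then have "b = int p * a" by (simp only: of_int_eq_iff)
  with ab(1) show False by simp
qed

text \<open>
  The form in which \<open>V\<close> is used as a discrete valuation ring: its units, the primality of \<open>p\<close>
  and the bound for powers below are read off from this dichotomy.
\<close>

lemma V_or_inverse_in_pV: "x \<in> V \<or> inverse x / of_nat p \<in> V"
proof -
  obtain a b where q: "quotient_of x = (a, b)" by fastforce
  have b: "b > 0" and x: "x = of_int a / of_int b" and cop: "coprime a b"
    using quotient_of_denom_pos[OF q] quotient_of_div[OF q] quotient_of_coprime[OF q] by auto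
  show ?thesis
  proof (cases "int p dvd b")
    case True
    then obtain c where c: "b = int p * c" by auto
    have "\<not> int p dvd a"
      using cop True prime_int_p by (metis coprime_common_divisor not_prime_unit)
    moreover have "inverse x / of_nat p = of_int c / of_int a"
      using x c b p_pos by (simp add: field_simps)
    ultimately show ?thesis by (metis VI)
  next
    case False
    then show ?thesis using VI x by blast
  qed
qed

lemma V_unit:
  assumes "x \<in> V" "x / of_nat p \<notin> V"
  shows "1 / x \<in> V" and "x \<noteq> 0"
proof -
  have "x \<noteq> 0" using assms by auto
  have "1 / x \<in> V"
    using V_or_inverse_in_pV[of "x / of_nat p"] assms p_pos by (simp add: field_simps)
  then show "1 / x \<in> V" "x \<noteq> 0" using \<open>x \<noteq> 0\<close> by auto
qed

lemma pV_prime: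
  assumes "x \<in> V" "y \<in> V" "x * y / of_nat p \<in> V"
  shows "x / of_nat p \<in> V \<or> y / of_nat p \<in> V"
proof (rule disjCI)
  assume "y / of_nat p \<notin> V"
  then have "1 / y \<in> V" "y \<noteq> 0" using V_unit[OF assms(2)] by auto
  then show "x / of_nat p \<in> V"
    using V_mult[OF \<open>1 / y \<in> V\<close> assms(3)] by simp
qed

lemma pV_power: "x \<in> V \<Longrightarrow> x ^ n / of_nat p \<in> V \<Longrightarrow> x / of_nat p \<in> V"
proof (induction n)
  case 0
  then show ?case using inverse_p_notin_V by simp
next
  case (Suc n)
  then show ?case using pV_prime[of x "x ^ n"] by auto
qed

lemma pV_imp_V: "x / of_nat p \<in> V \<Longrightarrow> x \<in> V"
  using V_mult[of "of_nat p" "x / of_nat p"] p_pos by simp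

text \<open>
  A number outside \<open>V\<close> has \<open>p\<close>-adic valuation at most \<open>-1\<close>, so \<open>p ^ n\<close> cannot clear the
  denominator of its \<open>(n + 1)\<close>-st power. This is how bounded denominators turn into integrality.
\<close>

lemma V_power_bounded:
  assumes "of_nat p ^ n * x ^ Suc n \<in> V"
  shows "x \<in> V"
proof (rule ccontr)
  assume x: "x \<notin> V"
  then have "inverse x / of_nat p \<in> V" using V_or_inverse_in_pV by blast
  then have "(inverse x / of_nat p) ^ Suc n * (of_nat p ^ n * x ^ Suc n) \<in> V"
    using assms by blast
  moreover have "(inverse x / of_nat p) ^ Suc n * (of_nat p ^ n * x ^ Suc n) = 1 / of_nat p"
  proof -
    have "x \<noteq> 0" using x by auto
    then show ?thesis using p_pos by (simp add: field_simps)
  qed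
  ultimately show False using inverse_p_notin_V by argo
qed

lemma denominator_bounded: "\<exists>M. of_nat p ^ M * x \<in> V"
proof -
  obtain a b where b: "b > 0" and x: "x = of_int a / of_int b"
    by (metis quotient_of_denom_pos quotient_of_div surj_pair)
  obtain M c where c: "b = int p ^ M * c" "\<not> int p dvd c"
    using multiplicity_decompose'[of b "int p"] b prime_int_p by (metis less_irrefl not_prime_unit)
  have "of_nat p ^ M * x = of_int a / of_int c"
    using x c(1) p_pos by simp
  then show ?thesis using VI[OF c(2)] by metis
qed

text \<open>
  The quotient \<open>V / p ^ n V\<close> is \<open>\<int> / p ^ n\<close>; its finiteness is what makes a single monic
  polynomial with integer coefficients work for all matrices at once in
  \<open>quadratic_imp_integral\<close>.
\<close>

lemma int_representative:
  assumes "x \<in> V"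
  shows "\<exists>i<p ^ n. (x - of_nat i) / of_nat p ^ n \<in> V"
proof -
  obtain a b where ab: "\<not> int p dvd b" "x = of_int a / of_int b" "b \<noteq> 0" using VE[OF assms] .
  have "coprime b (int p ^ n)"
    using ab(1) prime_int_p by (metis coprime_commute coprime_power_right_iff prime_imp_coprime_int)
  then obtain y where y: "[b * y = 1] (mod int p ^ n)"
    using cong_solve_coprime_int by blast
  define i where "i = nat (y * a mod int p ^ n)"
  have i: "int i = y * a mod int p ^ n" using p_pos by (simp add: i_def)
  then have "int i < int (p ^ n)" using p_pos by simp
  then have "i < p ^ n" by (simp only: of_nat_less_iff)
  have "[b * int i = b * (y * a)] (mod int p ^ n)"
    unfolding i by (simp add: cong_def mod_mult_right_eq)
  also have "[b * (y * a) = 1 * a] (mod int p ^ n)"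
    using cong_scalar_right[OF y, of a] by (simp add: mult.assoc)
  finally have "[a = b * int i] (mod int p ^ n)" by (simp add: cong_sym_eq)
  then have "int p ^ n dvd a - b * int i" by (simp add: cong_iff_dvd_diff)
  then obtain c where c: "a - b * int i = int p ^ n * c" by auto
  have "(of_int a :: rat) - of_int b * of_nat i = of_nat p ^ n * of_int c"
    using arg_cong[OF c, of "of_int :: int \<Rightarrow> rat"] by simp
  then have "(x - of_nat i) / of_nat p ^ n = of_int c / of_int b"
    using ab p_pos by (simp add: field_simps)
  then show ?thesis using VI[OF ab(1)] \<open>i < p ^ n\<close> by metis
qed

definition VX :: "rat poly set" where "VX = {f. \<forall>i. coeff f i \<in> V}"

lemma VX_0 [simp, intro]: "0 \<in> VX" by (simp add: VX_def)
lemma VX_pCons [simp]: "pCons a f \<in> VX \<longleftrightarrow> a \<in> V \<and> f \<in> VX"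
  by (auto simp: VX_def coeff_pCons split: nat.splits)
lemma VX_1 [simp, intro]: "1 \<in> VX" by (simp add: one_pCons)
lemma VX_add [simp, intro]: "f \<in> VX \<Longrightarrow> g \<in> VX \<Longrightarrow> f + g \<in> VX" by (simp add: VX_def)
lemma VX_diff [simp, intro]: "f \<in> VX \<Longrightarrow> g \<in> VX \<Longrightarrow> f - g \<in> VX" by (simp add: VX_def)
lemma VX_uminus [simp, intro]: "f \<in> VX \<Longrightarrow> - f \<in> VX" by (simp add: VX_def)
lemma VX_smult [simp, intro]: "c \<in> V \<Longrightarrow> f \<in> VX \<Longrightarrow> smult c f \<in> VX" by (simp add: VX_def)
lemma VX_mult [simp, intro]: "f \<in> VX \<Longrightarrow> g \<in> VX \<Longrightarrow> f * g \<in> VX"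
  by (auto simp: VX_def coeff_mult intro!: V_sum)
lemma VX_coeff [simp]: "f \<in> VX \<Longrightarrow> coeff f i \<in> V" by (simp add: VX_def)
lemma VX_power [simp, intro]: "f \<in> VX \<Longrightarrow> f ^ n \<in> VX" by (induction n) auto
lemma VX_sum [intro]: "(\<And>i. i \<in> I \<Longrightarrow> f i \<in> VX) \<Longrightarrow> sum f I \<in> VX"
  by (induction I rule: infinite_finite_induct) auto
lemma VX_prod [intro]: "(\<And>i. i \<in> I \<Longrightarrow> f i \<in> VX) \<Longrightarrow> prod f I \<in> VX"
  by (induction I rule: infinite_finite_induct) auto
lemma VX_poly [intro]: "f \<in> VX \<Longrightarrow> x \<in> V \<Longrightarrow> poly f x \<in> V"
  by (induction f rule: pCons_induct) auto

lemma denominators_bounded_poly: "\<exists>M. smult (of_nat p ^ M) f \<in> VX"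
proof (induction f rule: pCons_induct)
  case 0
  then show ?case by simp
next
  case (pCons a f)
  then obtain M where M: "smult (of_nat p ^ M) f \<in> VX" by auto
  obtain N where N: "of_nat p ^ N * a \<in> V" using denominator_bounded by blast
  have "of_nat p ^ (M + N) * a \<in> V"
    using V_mult[OF _ N, of "of_nat p ^ M"] by (simp add: power_add mult.assoc)
  moreover have "smult (of_nat p ^ (M + N)) f \<in> VX"
    using VX_smult[OF _ M, of "of_nat p ^ N"] by (simp add: power_add mult.commute)
  ultimately show ?case by (intro exI[of _ "M + N"]) simp
qed

end

section \<open>Integer-valued polynomials as remainders modulo quadratics\<close>

text \<open>
  Rewriting scalars as constant polynomials reduces identities that mix scalars, constants and
  polynomials to identities in a commutative ring.
\<close>

lemma const_poly_hom:
  fixes a b :: "'a::comm_ring_1"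
  shows "[:a + b:] = [:a:] + [:b:]" "[:a - b:] = [:a:] - [:b:]" "[:- a:] = - [:a:]"
    "[:a * b:] = [:a:] * [:b:]" "smult a f = [:a:] * f"
  by simp_all

lemma mod_poly_sum: "(\<Sum>k\<in>K. g k) mod m = (\<Sum>k\<in>K. g k mod (m :: 'a::field poly))"
  by (induction K rule: infinite_finite_induct) (auto simp: poly_mod_add_left)

abbreviation quad :: "rat \<Rightarrow> rat \<Rightarrow> rat poly" where
  "quad e d \<equiv> [:e, d, 1:]"

abbreviation X :: "rat poly" where "X \<equiv> [:0, 1:]"

lemma mod_quad_cases: obtains a b where "f mod quad e d = [:a, b:]"
proof -
  have "degree (f mod quad e d) < 2"
    using degree_mod_less'[of "quad e d" f] by (cases "f mod quad e d = 0") auto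
  then have "f mod quad e d = [:coeff (f mod quad e d) 0, coeff (f mod quad e d) 1:]"
    by (intro poly_eqI) (auto simp: coeff_pCons coeff_eq_0 split: nat.splits)
  then show ?thesis using that by blast
qed

lemma mod_quad_eqI:
  assumes "quad e d dvd f - [:a, b:]"
  shows "f mod quad e d = [:a, b:]"
proof -
  have "f mod quad e d = [:a, b:] mod quad e d"
    using assms by (simp add: mod_eq_dvd_iff)
  also have "\<dots> = [:a, b:]" by (rule mod_poly_less) simp
  finally show ?thesis .
qed

text \<open>
  A matrix that satisfies its characteristic equation \<open>A\<^sup>2 = - d A - e\<close> behaves like the class
  of \<open>X\<close> modulo \<open>X\<^sup>2 + d X + e\<close>. The equation is stated entrywise, which suits the matrix
  product of the fixed-size vector types.
\<close>

lemma matrix_power_mod_quad: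
  fixes A :: "rat^2^2"
  assumes A: "\<And>i j. (A ** A) $ i $ j = - d * A $ i $ j - (if i = j then e else 0)"
  shows "matrix_power A k $ i $ j =
    (if i = j then coeff (X ^ k mod quad e d) 0 else 0) + coeff (X ^ k mod quad e d) 1 * A $ i $ j"
proof (induction k arbitrary: i j)
  case 0
  have "X ^ 0 mod quad e d = [:1, 0:]" by (rule mod_quad_eqI) (simp add: one_pCons)
  then show ?case by (simp add: mat_def)
next
  case (Suc k)
  obtain a b where r: "X ^ k mod quad e d = [:a, b:]" by (rule mod_quad_cases)
  have "quad e d dvd X ^ k - [:a, b:]" unfolding r[symmetric] by (simp add: mod_eq_dvd_iff[symmetric])
  then have "quad e d dvd X * (X ^ k - [:a, b:]) + quad e d * [:b:]"
    by (intro dvd_add dvd_mult dvd_triv_left)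
  also have "X * (X ^ k - [:a, b:]) + quad e d * [:b:] = X ^ Suc k - [:- b * e, a - b * d:]"
    by (simp add: algebra_simps)
  finally have r': "X ^ Suc k mod quad e d = [:- b * e, a - b * d:]" by (rule mod_quad_eqI)
  have "matrix_power A (Suc k) $ i $ j
      = (\<Sum>l\<in>UNIV. A $ i $ l * ((if l = j then a else 0) + b * A $ l $ j))"
    by (auto simp: matrix_matrix_mult_def Suc.IH r intro!: sum.cong)
  also have "\<dots> = (\<Sum>l\<in>UNIV. A $ i $ l * (if l = j then a else 0)) + b * (A ** A) $ i $ j"
    by (simp add: matrix_matrix_mult_def algebra_simps sum.distrib sum_distrib_left)
  also have "(\<Sum>l\<in>UNIV. A $ i $ l * (if l = j then a else 0)) = a * A $ i $ j"
    by (simp add: if_distrib cong: if_cong)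
  finally show ?case unfolding r' A by (auto simp: algebra_simps)
qed

lemma matrix_poly_mod_quad:
  fixes A :: "rat^2^2"
  assumes A: "\<And>i j. (A ** A) $ i $ j = - d * A $ i $ j - (if i = j then e else 0)"
  shows "matrix_poly f A $ i $ j =
    (if i = j then coeff (f mod quad e d) 0 else 0) + coeff (f mod quad e d) 1 * A $ i $ j"
proof -
  have "f mod quad e d = (\<Sum>k\<le>degree f. monom (coeff f k) k) mod quad e d"
    by (simp add: poly_as_sum_of_monoms)
  also have "\<dots> = (\<Sum>k\<le>degree f. smult (coeff f k) (X ^ k mod quad e d))"
    by (simp add: mod_poly_sum monom_altdef mod_smult_left)
  finally have *: "f mod quad e d = (\<Sum>k\<le>degree f. smult (coeff f k) (X ^ k mod quad e d))" .
  have "matrix_poly f A $ i $ j = (\<Sum>k\<le>degree f. coeff f k * matrix_power A k $ i $ j)"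
    by (simp add: matrix_poly_def matrix_matrix_mult_def mat_def if_distrib
        if_distribR cong: if_cong)
  then show ?thesis
    unfolding matrix_power_mod_quad[OF A] *
    by (simp add: coeff_sum algebra_simps sum.distrib sum_distrib_left sum_distrib_right)
qed

context localization
begin

text \<open>
  The module \<open>V + V \<gamma>\<close> modulo \<open>m\<close>. It is a ring as soon as it contains \<open>\<gamma>\<^sup>2\<close>. For \<open>\<gamma> = X\<close> it is
  the image of \<open>V[X]\<close>; other choices of \<open>\<gamma>\<close> give integral extensions of \<open>V\<close> in \<open>\<rat>[X] / (m)\<close> that
  may be larger.
\<close>

definition adjoin :: "rat poly \<Rightarrow> rat poly \<Rightarrow> rat poly set" where
  "adjoin m \<gamma> = {f. \<exists>a\<in>V. \<exists>b\<in>V. m dvd f - ([:a:] + smult b \<gamma>)}"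

lemma adjoinI: "a \<in> V \<Longrightarrow> b \<in> V \<Longrightarrow> m dvd f - ([:a:] + smult b \<gamma>) \<Longrightarrow> f \<in> adjoin m \<gamma>"
  by (auto simp: adjoin_def)

lemma adjoinE:
  assumes "f \<in> adjoin m \<gamma>"
  obtains a b q where "a \<in> V" "b \<in> V" "f = [:a:] + smult b \<gamma> + m * q"
proof -
  obtain a b where ab: "a \<in> V" "b \<in> V" "m dvd f - ([:a:] + smult b \<gamma>)"
    using assms by (auto simp: adjoin_def)
  then obtain q where "f - ([:a:] + smult b \<gamma>) = m * q" by auto
  then have "f = [:a:] + smult b \<gamma> + m * q" by (simp add: algebra_simps)
  with ab that show ?thesis by blast
qed

lemma adjoin_cong:
  assumes "m dvd f - g" "g \<in> adjoin m \<gamma>"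
  shows "f \<in> adjoin m \<gamma>"
proof -
  obtain a b where ab: "a \<in> V" "b \<in> V" "m dvd g - ([:a:] + smult b \<gamma>)"
    using assms by (auto simp: adjoin_def)
  have "f - g + (g - ([:a:] + smult b \<gamma>)) = f - ([:a:] + smult b \<gamma>)" by simp
  with dvd_add[OF assms(1) ab(3)] show ?thesis by (intro adjoinI[OF ab(1,2)]) simp
qed

lemma adjoin_const [simp]: "c \<in> V \<Longrightarrow> [:c:] \<in> adjoin m \<gamma>"
  by (rule adjoinI[of c 0]) auto

lemma adjoin_0 [simp]: "0 \<in> adjoin m \<gamma>" and adjoin_1 [simp]: "1 \<in> adjoin m \<gamma>"
  using adjoin_const[of 0] adjoin_const[of 1] by (simp_all add: one_pCons)

lemma adjoin_generator [simp]: "\<gamma> \<in> adjoin m \<gamma>"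
  by (rule adjoinI[of 0 1]) auto

lemma adjoin_add [simp, intro]:
  assumes "f \<in> adjoin m \<gamma>" "g \<in> adjoin m \<gamma>"
  shows "f + g \<in> adjoin m \<gamma>"
proof -
  obtain a b q where f: "a \<in> V" "b \<in> V" "f = [:a:] + smult b \<gamma> + m * q" using adjoinE[OF assms(1)] .
  obtain a' b' q' where g: "a' \<in> V" "b' \<in> V" "g = [:a':] + smult b' \<gamma> + m * q'"
    using adjoinE[OF assms(2)] .
  have "f + g - ([:a + a':] + smult (b + b') \<gamma>) = m * (q + q')"
    unfolding f(3) g(3) const_poly_hom
    by (simp add: algebra_simps del: mult_pCons_left mult_pCons_right add_pCons diff_pCons minus_pCons)
  then show ?thesis using f(1,2) g(1,2) by (intro adjoinI[of "a + a'" "b + b'"]) auto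
qed

lemma adjoin_smult [simp, intro]:
  assumes "c \<in> V" "f \<in> adjoin m \<gamma>"
  shows "smult c f \<in> adjoin m \<gamma>"
proof -
  obtain a b q where f: "a \<in> V" "b \<in> V" "f = [:a:] + smult b \<gamma> + m * q" using adjoinE[OF assms(2)] .
  have "smult c f - ([:c * a:] + smult (c * b) \<gamma>) = m * smult c q"
    unfolding f(3) const_poly_hom
    by (simp add: algebra_simps del: mult_pCons_left mult_pCons_right add_pCons diff_pCons minus_pCons)
  then have "m dvd smult c f - ([:c * a:] + smult (c * b) \<gamma>)" by (metis dvd_triv_left)
  then show ?thesis using f(1,2) assms(1) by (intro adjoinI[of "c * a" "c * b"]) auto
qed

lemma adjoin_uminus [simp, intro]: "f \<in> adjoin m \<gamma> \<Longrightarrow> - f \<in> adjoin m \<gamma>"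
  using adjoin_smult[of "-1" f] by simp

lemma adjoin_diff [simp, intro]:
  "f \<in> adjoin m \<gamma> \<Longrightarrow> g \<in> adjoin m \<gamma> \<Longrightarrow> f - g \<in> adjoin m \<gamma>"
  using adjoin_add[of f m \<gamma> "- g"] by simp

lemma adjoin_dvd: "m dvd f \<Longrightarrow> f \<in> adjoin m \<gamma>"
  using adjoin_cong[of m f 0] by simp

lemma adjoin_sum: "(\<And>i. i \<in> I \<Longrightarrow> f i \<in> adjoin m \<gamma>) \<Longrightarrow> sum f I \<in> adjoin m \<gamma>"
  by (induction I rule: infinite_finite_induct) auto

lemma adjoin_mult:
  assumes rel: "\<gamma> * \<gamma> \<in> adjoin m \<gamma>"
    and "f \<in> adjoin m \<gamma>" "g \<in> adjoin m \<gamma>"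
  shows "f * g \<in> adjoin m \<gamma>"
proof -
  obtain a b q where f: "a \<in> V" "b \<in> V" "f = [:a:] + smult b \<gamma> + m * q" using adjoinE[OF assms(2)] .
  obtain a' b' q' where g: "a' \<in> V" "b' \<in> V" "g = [:a':] + smult b' \<gamma> + m * q'"
    using adjoinE[OF assms(3)] .
  have "f * g - ([:a * a':] + smult (a * b' + a' * b) \<gamma> + smult (b * b') (\<gamma> * \<gamma>))
      = m * (q * g + q' * ([:a:] + smult b \<gamma>))"
    unfolding f(3) g(3) const_poly_hom
    by (simp add: algebra_simps del: mult_pCons_left mult_pCons_right add_pCons diff_pCons minus_pCons)
  then have "m dvd f * g - ([:a * a':] + smult (a * b' + a' * b) \<gamma> + smult (b * b') (\<gamma> * \<gamma>))"
    by simp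
  then show ?thesis
    by (rule adjoin_cong) (use f g rel in auto)
qed

lemma adjoin_power:
  "\<gamma> * \<gamma> \<in> adjoin m \<gamma> \<Longrightarrow> f \<in> adjoin m \<gamma> \<Longrightarrow> f ^ n \<in> adjoin m \<gamma>"
  by (induction n) (auto intro: adjoin_mult)

lemma adjoin_prod:
  "\<gamma> * \<gamma> \<in> adjoin m \<gamma> \<Longrightarrow> (\<And>i. i \<in> I \<Longrightarrow> f i \<in> adjoin m \<gamma>) \<Longrightarrow> prod f I \<in> adjoin m \<gamma>"
  by (induction I rule: infinite_finite_induct) (auto intro: adjoin_mult)

text \<open>
  Factors that are each divisible by \<open>p\<close> contribute one power of \<open>p\<close> apiece. All powers of \<open>p\<close>
  needed to cancel the denominator of \<open>F\<close> are collected in this way.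
\<close>

lemma adjoin_prod_divided:
  assumes "\<gamma> * \<gamma> \<in> adjoin m \<gamma>" "\<And>i. i \<in> I \<Longrightarrow> smult (1 / of_nat p) (f i) \<in> adjoin m \<gamma>"
  shows "smult (1 / of_nat p ^ card I) (prod f I) \<in> adjoin m \<gamma>"
proof -
  have "smult (1 / of_nat p ^ card I) (prod f I) = (\<Prod>i\<in>I. smult (1 / of_nat p) (f i))"
    by (simp add: prod_smult power_one_over)
  then show ?thesis using adjoin_prod[OF assms(1), of I "\<lambda>i. smult (1 / of_nat p) (f i)"] assms(2) by simp
qed

lemma VX_subset_adjoin:
  assumes rel: "\<gamma> * \<gamma> \<in> adjoin m \<gamma>" and "X \<in> adjoin m \<gamma>" and "f \<in> VX"
  shows "f \<in> adjoin m \<gamma>"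
  using assms(3)
proof (induction f rule: pCons_induct)
  case 0
  then show ?case by simp
next
  case (pCons a f)
  have "pCons a f = [:a:] + X * f" by simp
  then show ?case using pCons adjoin_mult[OF rel assms(2)]
    by (metis VX_pCons adjoin_add adjoin_const)
qed

text \<open>
  With \<open>\<gamma>\<^sup>2 = s + t \<gamma>\<close> and \<open>f = a + b \<gamma>\<close>, the numbers \<open>T\<close> and \<open>E\<close> are the trace and the norm of
  multiplication by \<open>f\<close>.
\<close>

lemma adjoin_quadratic:
  assumes rel: "\<gamma> * \<gamma> \<in> adjoin m \<gamma>" and "f \<in> adjoin m \<gamma>"
  shows "\<exists>T\<in>V. \<exists>E\<in>V. m dvd f * f - smult T f + [:E:]"
proof -
  obtain s t r where g: "s \<in> V" "t \<in> V" "\<gamma> * \<gamma> = [:s:] + smult t \<gamma> + m * r" using adjoinE[OF rel] .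
  obtain a b q where f: "a \<in> V" "b \<in> V" "f = [:a:] + smult b \<gamma> + m * q" using adjoinE[OF assms(2)] .
  define T where "T = 2 * a + b * t"
  define E where "E = a * a + a * b * t - b * b * s"
  have bt: "T \<in> V" "E \<in> V" using f g unfolding T_def E_def by auto
  let ?u = "[:a:] + smult b \<gamma>"
  have "f * f - smult T f + [:E:] = m * (smult (b * b) r + q * (?u + f) - smult T q)"
  proof -
    have "f * f - smult T f + [:E:] = m * (smult (b * b) r + q * (?u + f) - smult T q)
        + smult (b * b) (\<gamma> * \<gamma> - ([:s:] + smult t \<gamma> + m * r))"
      unfolding f(3) T_def E_def const_poly_hom mult_2
      by (simp add: algebra_simps del: mult_pCons_left mult_pCons_right add_pCons diff_pCons minus_pCons)
    then show ?thesis using g(3) by simp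
  qed
  then have "m dvd f * f - smult T f + [:E:]" by simp
  then show ?thesis using bt by blast
qed

lemma X_rel: "e \<in> V \<Longrightarrow> d \<in> V \<Longrightarrow> X * X \<in> adjoin (quad e d) X"
  by (rule adjoinI[of "- e" "- d"]) auto

lemma adjoin_quad_X_iff:
  "f \<in> adjoin (quad e d) X \<longleftrightarrow> f mod quad e d \<in> VX"
proof
  assume "f \<in> adjoin (quad e d) X"
  then obtain a b where ab: "a \<in> V" "b \<in> V" "quad e d dvd f - ([:a:] + smult b X)"
    by (auto simp: adjoin_def)
  then show "f mod quad e d \<in> VX" using mod_quad_eqI[of e d f a b] by simp
next
  assume *: "f mod quad e d \<in> VX"
  obtain a b where r: "f mod quad e d = [:a, b:]" by (rule mod_quad_cases)
  have "quad e d dvd f - [:a, b:]" unfolding r[symmetric] by (simp add: mod_eq_dvd_iff[symmetric])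
  then show "f \<in> adjoin (quad e d) X" using * r by (intro adjoinI[of a b]) auto
qed

text \<open>
  One direction evaluates \<open>f\<close> at the companion matrix of the quadratic, whose first column
  displays the two coefficients of the remainder; the other one is the theorem of Cayley and
  Hamilton.
\<close>

lemma Int_M2_iff:
  "f \<in> Int_M2 p \<longleftrightarrow> (\<forall>e\<in>V. \<forall>d\<in>V. f \<in> adjoin (quad e d) X)"
proof
  assume f: "f \<in> Int_M2 p"
  show "\<forall>e\<in>V. \<forall>d\<in>V. f \<in> adjoin (quad e d) X"
  proof (intro ballI)
    fix e d assume ed: "e \<in> V" "d \<in> V"
    define C :: "rat^2^2" where
      "C = (\<chi> i j. if j = 1 then (if i = 1 then 0 else 1) else (if i = 1 then - e else - d))"
    have C: "C $ 1 $ 1 = 0" "C $ 2 $ 1 = 1" "C $ 1 $ 2 = - e" "C $ 2 $ 2 = - d"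
      by (simp_all add: C_def)
    have CC: "(C ** C) $ i $ j = - d * C $ i $ j - (if i = j then e else 0)" for i j
      using exhaust_2[of i] exhaust_2[of j] by (auto simp: matrix_matrix_mult_def sum_2 C)
    have "C \<in> M2 V" using ed by (auto simp: M2_def C_def)
    then have "matrix_poly f C \<in> M2 V" using f by (auto simp: Int_M2_def)
    then have "matrix_poly f C $ 1 $ 1 \<in> V" "matrix_poly f C $ 2 $ 1 \<in> V" by (auto simp: M2_def)
    then have "coeff (f mod quad e d) 0 \<in> V" "coeff (f mod quad e d) 1 \<in> V"
      by (simp_all add: matrix_poly_mod_quad[OF CC] C)
    moreover obtain a b where "f mod quad e d = [:a, b:]" by (rule mod_quad_cases)
    ultimately show "f \<in> adjoin (quad e d) X" by (simp add: adjoin_quad_X_iff)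
  qed
next
  assume *: "\<forall>e\<in>V. \<forall>d\<in>V. f \<in> adjoin (quad e d) X"
  have "matrix_poly f A \<in> M2 V" if A: "A \<in> M2 V" for A
  proof -
    define e where "e = A $ 1 $ 1 * A $ 2 $ 2 - A $ 1 $ 2 * A $ 2 $ 1"
    define d where "d = - (A $ 1 $ 1 + A $ 2 $ 2)"
    have AV: "A $ i $ j \<in> V" for i j using A by (simp add: M2_def)
    then have ed: "e \<in> V" "d \<in> V" by (auto simp: e_def d_def)
    have AA: "(A ** A) $ i $ j = - d * A $ i $ j - (if i = j then e else 0)" for i j
      using exhaust_2[of i] exhaust_2[of j]
      by (auto simp: matrix_matrix_mult_def sum_2 e_def d_def algebra_simps)
    have "f mod quad e d \<in> VX" using * ed by (simp add: adjoin_quad_X_iff)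
    then show ?thesis unfolding M2_def by (auto simp: matrix_poly_mod_quad[OF AA] AV)
  qed
  then show "f \<in> Int_M2 p" by (auto simp: Int_M2_def)
qed

lemma Int_M2_add: "f \<in> Int_M2 p \<Longrightarrow> g \<in> Int_M2 p \<Longrightarrow> f + g \<in> Int_M2 p"
  and Int_M2_mult: "f \<in> Int_M2 p \<Longrightarrow> g \<in> Int_M2 p \<Longrightarrow> f * g \<in> Int_M2 p"
  and VX_subset_Int_M2: "f \<in> VX \<Longrightarrow> f \<in> Int_M2 p"
  using adjoin_mult[OF X_rel] VX_subset_adjoin[OF X_rel] by (simp_all add: Int_M2_iff)

lemma Int_M2_power: "f \<in> Int_M2 p \<Longrightarrow> f ^ n \<in> Int_M2 p"
  by (induction n) (auto intro: Int_M2_mult VX_subset_Int_M2)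

lemma Int_M2_sum: "(\<And>i. i \<in> I \<Longrightarrow> f i \<in> Int_M2 p) \<Longrightarrow> sum f I \<in> Int_M2 p"
  by (induction I rule: infinite_finite_induct) (auto intro: Int_M2_add VX_subset_Int_M2)

end

section \<open>Integrality over the integer-valued polynomials\<close>

lemma to_fract_sum: "to_fract (sum f I) = (\<Sum>i\<in>I. to_fract (f i))"
  by (induction I rule: infinite_finite_induct) auto

lemma to_fract_power: "to_fract (f ^ n) = to_fract f ^ n"
  by (induction n) auto

lemma to_fract_prod: "to_fract (prod f I) = (\<Prod>i\<in>I. to_fract (f i))"
  by (induction I rule: infinite_finite_induct) auto

lemma coeff_prod_closed:
  assumes R: "0 \<in> R" "1 \<in> R" "\<And>x y. x \<in> R \<Longrightarrow> y \<in> R \<Longrightarrow> x + y \<in> R"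
      "\<And>x y. x \<in> R \<Longrightarrow> y \<in> R \<Longrightarrow> x * y \<in> R"
    and "\<And>i k. i \<in> I \<Longrightarrow> coeff (f i) k \<in> R"
  shows "coeff (prod f I) k \<in> R"
  using assms(5)
proof (induction I arbitrary: k rule: infinite_finite_induct)
  case (insert i I)
  have sum: "sum g J \<in> R" if "\<And>j. j \<in> J \<Longrightarrow> g j \<in> R" for g and J :: "nat set"
    using that by (induction J rule: infinite_finite_induct) (auto intro: R)
  show ?case using insert by (auto simp: coeff_mult intro!: sum R)
qed (auto simp: R)

text \<open>
  The norm from \<open>\<rat>[X] / (X\<^sup>2 + d X + e)\<close> down to \<open>\<rat>\<close>, or equivalently the determinant of \<open>f\<close>
  evaluated at the companion matrix.
\<close>

definition quad_norm :: "rat \<Rightarrow> rat \<Rightarrow> rat poly \<Rightarrow> rat" where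
  "quad_norm e d f = (let a = coeff (f mod quad e d) 0; b = coeff (f mod quad e d) 1
     in a * a - d * a * b + e * b * b)"

lemma quad_normI:
  assumes "quad e d dvd f - [:a, b:]"
  shows "quad_norm e d f = a * a - d * a * b + e * b * b"
  using mod_quad_eqI[OF assms] by (simp add: quad_norm_def)

lemma dvd_minus_mod_quad:
  obtains a b where "quad e d dvd f - [:a, b:]"
proof -
  obtain a b where "f mod quad e d = [:a, b:]" by (rule mod_quad_cases)
  then have "quad e d dvd f - [:a, b:]" by (metis dvd_minus_mod)
  then show ?thesis using that by blast
qed

lemma quad_norm_mult: "quad_norm e d (f * g) = quad_norm e d f * quad_norm e d g"
proof -
  obtain a b where f: "quad e d dvd f - [:a, b:]" by (rule dvd_minus_mod_quad)
  obtain a' b' where g: "quad e d dvd g - [:a', b':]" by (rule dvd_minus_mod_quad)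
  have "quad e d dvd (f - [:a, b:]) * g + [:a, b:] * (g - [:a', b':]) + quad e d * [:b * b':]"
    using f g by (intro dvd_add dvd_mult dvd_mult2 dvd_triv_left)
  also have "(f - [:a, b:]) * g + [:a, b:] * (g - [:a', b':]) + quad e d * [:b * b':]
      = f * g - [:a, b:] * [:a', b':] + quad e d * [:b * b':]"
    by (simp add: algebra_simps del: mult_pCons_left mult_pCons_right)
  also have "\<dots> = f * g - [:a * a' - e * (b * b'), a * b' + a' * b - d * (b * b'):]"
    by (simp add: algebra_simps)
  finally show ?thesis
    by (simp add: quad_normI[OF f] quad_normI[OF g] quad_normI) (simp add: algebra_simps)
qed

lemma quad_norm_1: "quad_norm e d 1 = 1"
  using quad_normI[of e d 1 1 0] by (simp add: one_pCons)

lemma quad_norm_power: "quad_norm e d (f ^ n) = quad_norm e d f ^ n"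
  by (induction n) (auto simp: quad_norm_1 quad_norm_mult)

lemma quad_norm_const: "quad_norm e d [:c:] = c * c"
  using quad_normI[of e d "[:c:]" c 0] by simp

lemma quad_norm_smult: "quad_norm e d (smult c f) = c * c * quad_norm e d f"
  using quad_norm_mult[of e d "[:c:]" f] by (simp add: quad_norm_const)

context localization
begin

lemma quad_norm_in_V: "e \<in> V \<Longrightarrow> d \<in> V \<Longrightarrow> f \<in> adjoin (quad e d) X \<Longrightarrow> quad_norm e d f \<in> V"
  by (auto simp: adjoin_quad_X_iff quad_norm_def Let_def)

text \<open>
  An equation of integral dependence for \<open>g\<close> expresses every power of \<open>g\<close> through the first few
  ones with integer-valued coefficients. So the denominators of all powers of \<open>g\<close> modulo the
  quadratic are bounded by one power of \<open>p\<close>, and those of all powers of the norm of \<open>g\<close> too.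
\<close>

lemma integral_imp_quad_norm_in_V:
  assumes int: "to_fract g \<in> integral_closure_of (to_fract ` Int_M2 p)"
    and ed: "e \<in> V" "d \<in> V"
  shows "quad_norm e d g \<in> V"
proof -
  define S where "S = adjoin (quad e d) X"
  obtain P where P: "lead_coeff P = 1" "\<And>i. coeff P i \<in> to_fract ` Int_M2 p" "poly P (to_fract g) = 0"
    using int by (auto simp: integral_closure_of_def)
  define n where "n = degree P"
  from P(2) have "\<forall>i. \<exists>c. c \<in> Int_M2 p \<and> coeff P i = to_fract c" by blast
  then obtain c where c: "\<And>i. c i \<in> Int_M2 p" "\<And>i. coeff P i = to_fract (c i)" by metis
  have cn: "c n = 1" using P(1) c(2)[of n] by (metis n_def to_fract_1 to_fract_eq_iff)
  have "to_fract (\<Sum>i\<le>n. c i * g ^ i) = poly P (to_fract g)"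
    by (simp add: poly_altdef to_fract_sum to_fract_power c(2)[symmetric] n_def)
  then have "(\<Sum>i\<le>n. c i * g ^ i) = 0" using P(3) to_fract_eq_0_iff by metis
  then have gn: "g ^ n = - (\<Sum>i<n. c i * g ^ i)"
    by (simp add: lessThan_Suc_atMost[symmetric] cn add_eq_0_iff)
  obtain K where K: "smult (of_nat p ^ K) g \<in> VX" using denominators_bounded_poly by blast
  define M where "M = K * n"
  \<comment> \<open>Integrality bounds the denominators of all powers of \<open>g\<close> at once.\<close>
  have bounded: "smult (of_nat p ^ M) (g ^ k) \<in> S" for k
  proof (induction k rule: less_induct)
    case (less k)
    show ?case
    proof (cases "k < n")
      case True
      have "M = K * (n - k) + K * k"
        using True by (simp add: M_def diff_mult_distrib2)
      then have "smult (of_nat p ^ M) (g ^ k) = smult (of_nat p ^ (K * (n - k))) (smult (of_nat p ^ K) g ^ k)"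
        by (simp add: smult_power power_add power_mult)
      also have "\<dots> \<in> VX" using K by auto
      finally show ?thesis
        unfolding S_def using VX_subset_adjoin[OF X_rel[OF ed]] by simp
    next
      case False
      then have "g ^ k = g ^ (k - n) * g ^ n" by (simp add: power_add[symmetric])
      also have "\<dots> = - (\<Sum>i<n. c i * g ^ (k - n + i))"
        by (simp add: gn sum_distrib_left power_add algebra_simps)
      finally have "smult (of_nat p ^ M) (g ^ k) = - (\<Sum>i<n. c i * smult (of_nat p ^ M) (g ^ (k - n + i)))"
        by (simp add: smult_sum2)
      moreover have "c i * smult (of_nat p ^ M) (g ^ (k - n + i)) \<in> S" if "i < n" for i
        unfolding S_def
      proof (rule adjoin_mult[OF X_rel[OF ed]])
        show "c i \<in> adjoin (quad e d) X" using c(1)[of i] ed Int_M2_iff by blast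
        show "smult (of_nat p ^ M) (g ^ (k - n + i)) \<in> adjoin (quad e d) X"
          using less.IH[of "k - n + i"] that False by (simp add: S_def)
      qed
      ultimately show ?thesis unfolding S_def by (simp only:) (intro adjoin_uminus adjoin_sum, simp)
    qed
  qed
  have "of_nat p ^ (2 * M) * quad_norm e d g ^ Suc (2 * M)
      = quad_norm e d (smult (of_nat p ^ M) (g ^ Suc (2 * M)))"
    by (simp only: quad_norm_smult quad_norm_power mult_2 power_add)
  also have "\<dots> \<in> V" using bounded ed quad_norm_in_V S_def by blast
  finally show ?thesis by (rule V_power_bounded)
qed

text \<open>
  Suppose that \<open>p ^ M f\<close> has coefficients in \<open>V\<close>. Up to multiples of \<open>p ^ (2 M)\<close> there are
  finitely many trace-norm pairs \<open>(T, E)\<close>; let \<open>\<phi>\<close> be the product of \<open>Y\<^sup>2 - i Y + j\<close> over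
  integers \<open>i\<close> and \<open>j\<close> that represent them all. Modulo a given quadratic, the factor with
  \<open>(i, j)\<close> close to \<open>(T, E)\<close> takes at \<open>f\<close> a value \<open>p ^ (2 M) (\<alpha> f - \<beta>)\<close> with \<open>\<alpha>\<close> and \<open>\<beta>\<close> in \<open>V\<close>.
  Half of the power of \<open>p\<close> clears the denominators of \<open>\<alpha> f - \<beta>\<close>, the other half those of the
  remaining factors. Hence \<open>\<phi>(f)\<close> is integer-valued, and \<open>f\<close> is a root of the monic polynomial
  \<open>\<phi> - \<phi>(f)\<close>.
\<close>

lemma quadratic_imp_integral:
  assumes "\<And>e d. e \<in> V \<Longrightarrow> d \<in> V \<Longrightarrow> \<exists>T\<in>V. \<exists>E\<in>V. quad e d dvd f * f - smult T f + [:E:]"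
  shows "to_fract f \<in> integral_closure_of (to_fract ` Int_M2 p)"
proof -
  obtain M where M: "smult (of_nat p ^ M) f \<in> VX" using denominators_bounded_poly by blast
  define q where "q = p ^ (2 * M)"
  have q: "0 < q" using p_pos by (simp add: q_def)
  define u where "u = (\<lambda>(i, j). f * f - smult (of_nat i) f + [:of_nat j:])"
  define J where "J = {..<q} \<times> {..<q}"
  have fin: "finite J" by (simp add: J_def)
  have phi: "prod u J \<in> Int_M2 p"
    unfolding Int_M2_iff
  proof (intro ballI)
    fix e d assume ed: "e \<in> V" "d \<in> V"
    let ?S = "adjoin (quad e d) X"
    have VS: "g \<in> ?S" if "g \<in> VX" for g
      using VX_subset_adjoin[OF X_rel[OF ed]] that by simp
    obtain T E where TE: "T \<in> V" "E \<in> V" "quad e d dvd f * f - smult T f + [:E:]"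
      using assms[OF ed] by blast
    obtain i where i: "i < q" "(T - of_nat i) / of_nat p ^ (2 * M) \<in> V"
      using int_representative[OF TE(1), of "2 * M"] by (auto simp: q_def)
    obtain j where j: "j < q" "(E - of_nat j) / of_nat p ^ (2 * M) \<in> V"
      using int_representative[OF TE(2), of "2 * M"] by (auto simp: q_def)
    define \<alpha> \<beta> where "\<alpha> = (T - of_nat i) / of_nat p ^ (2 * M)" "\<beta> = (E - of_nat j) / of_nat p ^ (2 * M)"
    have ab: "\<alpha> \<in> V" "\<beta> \<in> V" "T = of_nat i + of_nat p ^ M * of_nat p ^ M * \<alpha>"
        "E = of_nat j + of_nat p ^ M * of_nat p ^ M * \<beta>"
      using i j p_pos by (simp_all add: \<alpha>_\<beta>_def mult_2 power_add)
    define w where "w = smult (1 / of_nat p ^ M) (u (i, j))"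
    have uw: "u (i, j) = smult (of_nat p ^ M) w" using p_pos by (simp add: w_def)
    have "w = smult (1 / of_nat p ^ M) (f * f - smult T f + [:E:])
        + (smult \<alpha> (smult (of_nat p ^ M) f) - [:of_nat p ^ M * \<beta>:])"
      using p_pos unfolding w_def u_def ab(3,4) by (simp add: algebra_simps smult_add_left smult_add_right smult_diff_right)
    moreover have "smult (1 / of_nat p ^ M) (f * f - smult T f + [:E:]) \<in> ?S"
      using TE(3) by (intro adjoin_dvd dvd_smult)
    moreover have "smult \<alpha> (smult (of_nat p ^ M) f) - [:of_nat p ^ M * \<beta>:] \<in> VX"
      using M ab(1,2) by (intro VX_diff VX_smult[of \<alpha>]) auto
    ultimately have w: "w \<in> ?S" using VS by simp
    \<comment> \<open>The other factors may have denominators, but stay in \<open>V + V f\<close>.\<close>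
    have rel: "f * f \<in> adjoin (quad e d) f"
    proof (rule adjoinI[of "- E" T])
      have "f * f - ([:- E:] + smult T f) = f * f - smult T f + [:E:]"
        by (simp only: const_poly_hom(3))
      then show "quad e d dvd f * f - ([:- E:] + smult T f)" using TE(3) by (simp only:)
    qed (use TE in auto)
    have "u k \<in> adjoin (quad e d) f" for k
      unfolding u_def by (cases k) (auto intro!: adjoin_add adjoin_diff rel)
    then have "prod u (J - {(i, j)}) \<in> adjoin (quad e d) f" by (intro adjoin_prod rel)
    then obtain a b r where r: "a \<in> V" "b \<in> V" "prod u (J - {(i, j)}) = [:a:] + smult b f + quad e d * r"
      by (rule adjoinE)
    have "smult (of_nat p ^ M) (prod u (J - {(i, j)}))
        = ([:of_nat p ^ M * a:] + smult b (smult (of_nat p ^ M) f)) + quad e d * smult (of_nat p ^ M) r"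
      unfolding r(3) by (simp add: smult_add_right mult.commute)
    moreover have "[:of_nat p ^ M * a:] + smult b (smult (of_nat p ^ M) f) \<in> VX"
      using M r(1,2) by (intro VX_add VX_smult[of b]) auto
    ultimately have r': "smult (of_nat p ^ M) (prod u (J - {(i, j)})) \<in> ?S"
      using VS adjoin_dvd[of "quad e d" "quad e d * smult (of_nat p ^ M) r"] by (metis adjoin_add dvd_triv_left)
    have "(i, j) \<in> J" using i j by (simp add: J_def)
    then have "prod u J = w * smult (of_nat p ^ M) (prod u (J - {(i, j)}))"
      using prod.remove[OF fin, of "(i, j)" u] uw by simp
    then show "prod u J \<in> ?S" using adjoin_mult[OF X_rel[OF ed] w r'] by simp
  qed
  define Q where "Q = (\<Prod>(i, j)\<in>J. [:of_nat j, - of_nat i, 1 :: rat poly fract:])"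
  have "lead_coeff Q = 1" unfolding Q_def by (simp add: lead_coeff_prod split_def)
  have "degree Q = (\<Sum>k\<in>J. 2)" unfolding Q_def by (subst degree_prod_eq_sum_degree) (auto simp: split_def)
  then have degQ: "degree Q > 0" using q by (simp add: J_def)
  define P where "P = Q - [:to_fract (prod u J):]"
  have "degree P = degree Q" unfolding P_def diff_conv_add_uminus
    by (rule degree_add_eq_left) (use degQ in simp)
  have lead: "lead_coeff P = 1"
    using degQ \<open>degree P = degree Q\<close> \<open>lead_coeff Q = 1\<close> by (simp add: P_def coeff_pCons split: nat.splits)
  let ?R = "to_fract ` Int_M2 p"
  have R01: "0 \<in> ?R" "1 \<in> ?R"
    using VX_subset_Int_M2[of 0] VX_subset_Int_M2[of 1]
    by (auto intro: image_eqI[of _ _ 0] image_eqI[of _ _ 1])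
  have R_add: "x + y \<in> ?R" and R_mult: "x * y \<in> ?R" if "x \<in> ?R" "y \<in> ?R" for x y
    using that Int_M2_add Int_M2_mult by (auto simp flip: to_fract_add to_fract_mult)
  have R_minus: "- x \<in> ?R" if "x \<in> ?R" for x
    using that Int_M2_mult[OF VX_subset_Int_M2[of "- 1"]] by (auto simp flip: to_fract_uminus)
  have R_nat: "of_nat n \<in> ?R" for n by (induction n) (auto intro: R_add R01)
  have "coeff Q k \<in> to_fract ` Int_M2 p" for k
    unfolding Q_def
  proof (rule coeff_prod_closed[OF R01 R_add R_mult])
    fix k l :: nat and ij assume "ij \<in> J"
    show "coeff (case ij of (i, j) \<Rightarrow> [:of_nat j, - of_nat i, 1:]) l \<in> ?R"
      by (auto simp: split_def coeff_pCons R01 R_minus R_nat split: nat.splits)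
  qed
  moreover have "to_fract (prod u J) \<in> ?R" using phi by blast
  ultimately have cf: "coeff P k \<in> ?R" for k
    unfolding P_def using R_add[OF _ R_minus] by (auto simp: coeff_pCons split: nat.splits)
  have root: "poly P (to_fract f) = 0"
  proof -
    have nat: "to_fract [:of_nat k:] = (of_nat k :: rat poly fract)" for k
      by (induction k) (simp_all add: const_poly_hom one_pCons[symmetric] del: add_pCons)
    have "to_fract (u k) = poly [:of_nat (snd k), - of_nat (fst k), 1:] (to_fract f)" for k
      by (cases k) (simp add: u_def const_poly_hom(5) nat algebra_simps del: mult_pCons_left mult_pCons_right)
    then have "to_fract (prod u J) = poly Q (to_fract f)"
      by (simp add: Q_def to_fract_prod poly_prod split_def)
    then show ?thesis by (simp add: P_def)
  qed
  show ?thesis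
    unfolding integral_closure_of_def using lead cf root by (intro CollectI exI[of _ P]) simp
qed

end

section \<open>Reduction modulo p\<close>

lemma monic_quadratic_irreducible_or_splits:
  fixes e d :: "'a::field"
  shows "irreducible [:e, d, 1:] \<or> (\<exists>a b. [:e, d, 1:] = [:- a, 1:] * [:- b, 1:])"
proof (cases "\<exists>a. poly [:e, d, 1:] a = 0")
  case True
  then obtain a where "poly [:e, d, 1:] a = 0" by blast
  then have "e + a * (d + a) = 0" by simp
  then have "e = - (a * (d + a))" by (simp add: eq_neg_iff_add_eq_0)
  then have "[:e, d, 1:] = [:- a, 1:] * [:- (- d - a), 1:]" by (simp add: algebra_simps)
  then show ?thesis by blast
next
  case False
  have "irreducible [:e, d, 1:]"
  proof (rule irreducibleI)
    show "\<not> [:e, d, 1:] dvd 1" by (simp add: poly_dvd_1)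
    fix f g assume fg: "[:e, d, 1:] = f * g"
    have nz: "f \<noteq> 0" "g \<noteq> 0" using fg by auto
    have no_linear: "degree k \<noteq> 1" if "k dvd [:e, d, 1:]" for k
    proof
      assume "degree k = 1"
      then obtain u v where k: "k = [:u, v:]" "v \<noteq> 0" by (metis degree1_coeffs)
      then have "poly k (- u / v) = 0" by simp
      with that False show False by (metis dvd_def poly_mult mult_zero_left)
    qed
    have "degree (f * g) = 2" unfolding fg[symmetric] by simp
    then have "degree f + degree g = 2" using nz by (simp add: degree_mult_eq)
    moreover have "degree f \<noteq> 1" "degree g \<noteq> 1"
      using no_linear[of f] no_linear[of g] fg by auto
    ultimately have "degree f = 0 \<or> degree g = 0" by linarith
    then show "f dvd 1 \<or> g dvd 1" using nz by (auto simp: is_unit_iff_degree)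
  qed simp
  then show ?thesis ..
qed

locale construction = localization p
  for p :: nat +
  fixes \<pi> :: rat
    and rep :: "'p::prime_card mod_ring \<Rightarrow> rat"
    and lift :: "'p mod_ring poly \<Rightarrow> rat poly"
  assumes card_p: "CARD('p) = p"
    and uniformizer: "(\<lambda>x. \<pi> * x) ` Z_loc p = (\<lambda>x. of_nat p * x) ` Z_loc p"
    and reps: "residue_representatives rep"
    and lifts: "monic_lifts lift"
begin

abbreviation res :: "rat \<Rightarrow> 'p mod_ring" where "res \<equiv> red"

lemma res_divide: "\<not> int p dvd b \<Longrightarrow> res (of_int a / of_int b) = of_int a / of_int b"
  using red_divide[where 'p = 'p, of b a] card_p by simp

lemma of_int_res_nonzero: "\<not> int p dvd b \<Longrightarrow> (of_int b :: 'p mod_ring) \<noteq> 0"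
  using of_int_mod_ring_eq_0_iff[where 'p = 'p, of b] card_p by simp

lemma res_add [simp]: assumes "x \<in> V" "y \<in> V" shows "res (x + y) = res x + res y"
proof -
  obtain a b where ab: "\<not> int p dvd b" "x = of_int a / of_int b" "b \<noteq> 0" using VE[OF assms(1)] .
  obtain c d where cd: "\<not> int p dvd d" "y = of_int c / of_int d" "d \<noteq> 0" using VE[OF assms(2)] .
  have bd: "\<not> int p dvd b * d" using ab cd prime_int_p by (simp add: prime_dvd_mult_iff)
  have xy: "x + y = of_int (a * d + c * b) / of_int (b * d)"
    using ab cd by (simp add: field_simps)
  have "res (x + y) = of_int (a * d + c * b) / of_int (b * d)" by (simp only: xy res_divide[OF bd])
  then show ?thesis
    using of_int_res_nonzero[OF ab(1)] of_int_res_nonzero[OF cd(1)]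
    by (simp add: ab(2) cd(2) res_divide[OF ab(1)] res_divide[OF cd(1)] add_frac_eq)
qed

lemma res_mult [simp]: assumes "x \<in> V" "y \<in> V" shows "res (x * y) = res x * res y"
proof -
  obtain a b where ab: "\<not> int p dvd b" "x = of_int a / of_int b" "b \<noteq> 0" using VE[OF assms(1)] .
  obtain c d where cd: "\<not> int p dvd d" "y = of_int c / of_int d" "d \<noteq> 0" using VE[OF assms(2)] .
  have bd: "\<not> int p dvd b * d" using ab cd prime_int_p by (simp add: prime_dvd_mult_iff)
  have xy: "x * y = of_int (a * c) / of_int (b * d)"
    using ab cd by (simp add: field_simps)
  have "res (x * y) = of_int (a * c) / of_int (b * d)" by (simp only: xy res_divide[OF bd])
  then show ?thesis by (simp add: ab(2) cd(2) res_divide[OF ab(1)] res_divide[OF cd(1)])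
qed

lemma res_of_int [simp]: "res (of_int a) = of_int a"
proof -
  have "\<not> int p dvd 1" using prime_int_p by (metis not_prime_unit)
  from res_divide[OF this, of a] show ?thesis by simp
qed

lemma res_0 [simp]: "res 0 = 0" and res_1 [simp]: "res 1 = 1"
  using res_of_int[of 0] res_of_int[of 1] by simp_all

lemma res_numeral [simp]: "res (numeral n) = numeral n"
  using res_of_int[of "numeral n"] by simp

lemma res_uminus [simp]: "x \<in> V \<Longrightarrow> res (- x) = - res x"
  using res_add[of "- x" x] by (simp add: eq_neg_iff_add_eq_0 del: res_add)

lemma res_diff [simp]: "x \<in> V \<Longrightarrow> y \<in> V \<Longrightarrow> res (x - y) = res x - res y"
  using res_add[of x "- y"] by (simp del: res_add)

lemma res_sum: "(\<And>i. i \<in> I \<Longrightarrow> f i \<in> V) \<Longrightarrow> res (sum f I) = (\<Sum>i\<in>I. res (f i))"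
  by (induction I rule: infinite_finite_induct) (auto simp: V_sum)

lemma res_eq_0_iff: assumes "x \<in> V" shows "res x = 0 \<longleftrightarrow> x / of_nat p \<in> V"
proof -
  obtain a b where ab: "\<not> int p dvd b" "x = of_int a / of_int b" "b \<noteq> 0" using VE[OF assms] .
  have "res x = 0 \<longleftrightarrow> (of_int a :: 'p mod_ring) = 0"
    unfolding ab(2) res_divide[OF ab(1)] using of_int_res_nonzero[OF ab(1)] by simp
  also have "\<dots> \<longleftrightarrow> int p dvd a"
    using of_int_mod_ring_eq_0_iff[where 'p = 'p, of a] card_p by simp
  also have "\<dots> \<longleftrightarrow> x / of_nat p \<in> V"
  proof
    assume "int p dvd a"
    then obtain c where "a = int p * c" by auto
    then have "x / of_nat p = of_int c / of_int b" using ab p_pos by simp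
    then show "x / of_nat p \<in> V" using VI[OF ab(1)] by simp
  next
    assume "x / of_nat p \<in> V"
    then obtain c d where cd: "\<not> int p dvd d" "x / of_nat p = of_int c / of_int d" "d \<noteq> 0" by (rule VE)
    then have "(of_int (a * d) :: rat) = of_int (int p * (b * c))"
      using ab p_pos by (simp add: field_simps)
    then have "a * d = int p * (b * c)" by (simp only: of_int_eq_iff)
    then have "int p dvd a * d" by simp
    then show "int p dvd a" using cd(1) prime_int_p by (simp add: prime_dvd_mult_iff)
  qed
  finally show ?thesis .
qed

lemma rep_V [simp]: "rep a \<in> V" and res_rep [simp]: "res (rep a) = a"
  using reps by (auto simp: residue_representatives_def card_p)

abbreviation res_poly :: "rat poly \<Rightarrow> 'p mod_ring poly" where "res_poly \<equiv> map_poly red"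

lemma coeff_res_poly [simp]: "coeff (res_poly f) i = res (coeff f i)"
  by (simp add: coeff_map_poly)

lemma res_poly_0 [simp]: "res_poly 0 = 0"
  by (rule poly_eqI) simp

lemma res_poly_pCons [simp]: "res_poly (pCons a f) = pCons (res a) (res_poly f)"
  by (rule poly_eqI) (simp add: coeff_pCons split: nat.splits)

lemma res_poly_1 [simp]: "res_poly 1 = 1"
  by (simp add: one_pCons)

lemma res_poly_add [simp]: "f \<in> VX \<Longrightarrow> g \<in> VX \<Longrightarrow> res_poly (f + g) = res_poly f + res_poly g"
  by (rule poly_eqI) simp

lemma res_poly_diff [simp]: "f \<in> VX \<Longrightarrow> g \<in> VX \<Longrightarrow> res_poly (f - g) = res_poly f - res_poly g"
  by (rule poly_eqI) simp

lemma res_poly_uminus [simp]: "f \<in> VX \<Longrightarrow> res_poly (- f) = - res_poly f"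
  by (rule poly_eqI) simp

lemma res_poly_smult [simp]: "c \<in> V \<Longrightarrow> f \<in> VX \<Longrightarrow> res_poly (smult c f) = smult (res c) (res_poly f)"
  by (rule poly_eqI) simp

lemma res_poly_mult [simp]: "f \<in> VX \<Longrightarrow> g \<in> VX \<Longrightarrow> res_poly (f * g) = res_poly f * res_poly g"
  by (rule poly_eqI) (simp add: coeff_mult res_sum)

lemma res_poly_power [simp]: "f \<in> VX \<Longrightarrow> res_poly (f ^ n) = res_poly f ^ n"
  by (induction n) auto

lemma res_poly_sum: "(\<And>i. i \<in> I \<Longrightarrow> f i \<in> VX) \<Longrightarrow> res_poly (sum f I) = (\<Sum>i\<in>I. res_poly (f i))"
  by (induction I rule: infinite_finite_induct) (auto simp: VX_sum)

lemma res_poly_prod: "(\<And>i. i \<in> I \<Longrightarrow> f i \<in> VX) \<Longrightarrow> res_poly (prod f I) = (\<Prod>i\<in>I. res_poly (f i))"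
  by (induction I rule: infinite_finite_induct) (auto simp: VX_prod)

lemma res_poly_eq_0_iff: "f \<in> VX \<Longrightarrow> res_poly f = 0 \<longleftrightarrow> smult (1 / of_nat p) f \<in> VX"
  by (simp add: poly_eq_iff res_eq_0_iff) (simp add: VX_def del: VX_coeff)

lemma poly_res_poly: "f \<in> VX \<Longrightarrow> a \<in> V \<Longrightarrow> poly (res_poly f) (res a) = res (poly f a)"
  by (induction f rule: pCons_induct) (auto simp: VX_poly)

text \<open>
  \<open>K\<close> differs from the modulus by an element of \<open>p V[X]\<close>.
\<close>

lemma divided_by_p_in_adjoin:
  assumes "K \<in> VX" "e \<in> V" "d \<in> V" "res_poly K = res_poly (quad e d)"
  shows "smult (1 / of_nat p) K \<in> adjoin (quad e d) X"
proof -
  have "res_poly (K - quad e d) = 0" using assms by simp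
  then have "smult (1 / of_nat p) (K - quad e d) \<in> VX"
    using assms by (subst res_poly_eq_0_iff[symmetric]) auto
  then have "smult (1 / of_nat p) (K - quad e d) \<in> adjoin (quad e d) X"
    using VX_subset_adjoin[OF X_rel] assms by simp
  moreover have "quad e d dvd smult (1 / of_nat p) K - smult (1 / of_nat p) (K - quad e d)"
    by (simp only: smult_diff_right[symmetric]) (rule dvd_smult, simp)
  ultimately show ?thesis by (rule adjoin_cong[rotated])
qed

abbreviation irr :: "'p mod_ring poly set" where "irr \<equiv> monic_irred2"

abbreviation lin :: "'p mod_ring \<Rightarrow> rat poly" where "lin a \<equiv> [:- rep a, 1:]"

lemma lift_props [simp]:
  assumes "f \<in> irr"
  shows "lift f \<in> VX" "res_poly (lift f) = f" "degree (lift f) = 2" "lead_coeff (lift f) = 1"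
    "coeff (lift f) 2 = 1" "lift f \<noteq> 0"
proof -
  show *: "lift f \<in> VX" "res_poly (lift f) = f" "degree (lift f) = 2" "lead_coeff (lift f) = 1"
    using lifts assms unfolding monic_lifts_def VX_def card_p by auto
  show "coeff (lift f) 2 = 1" "lift f \<noteq> 0" using *(3,4) by auto
qed

lemma residue_cases:
  assumes "e \<in> V" "d \<in> V"
  obtains (irreducible) f where "f \<in> irr" "res_poly (lift f) = res_poly (quad e d)"
  | (split) a b where "res_poly (lin a * lin b) = res_poly (quad e d)"
proof -
  have m: "res_poly (quad e d) = [:res e, res d, 1:]" by simp
  from monic_quadratic_irreducible_or_splits[of "res e" "res d"] show ?thesis
  proof
    assume "irreducible [:res e, res d, 1:]"
    then have "res_poly (quad e d) \<in> irr" by (simp add: monic_irred2_def)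
    then show ?thesis using irreducible[of "res_poly (quad e d)"] by simp
  next
    assume "\<exists>a b. [:res e, res d, 1:] = [:- a, 1:] * [:- b, 1:]"
    then obtain a b where "[:res e, res d, 1:] = [:- a, 1:] * [:- b, 1:]" by blast
    moreover have "res_poly (lin a * lin b) = [:- a, 1:] * [:- b, 1:]" by (subst res_poly_mult) simp_all
    ultimately show ?thesis using split[of a b] m by simp
  qed
qed

lemma uniformizer_associated:
  shows pi_div_p: "\<pi> / of_nat p \<in> V" and p_div_pi: "of_nat p / \<pi> \<in> V" and pi_nz: "\<pi> \<noteq> 0" and pi_V [simp]: "\<pi> \<in> V"
proof -
  obtain y where y: "y \<in> V" "\<pi> * 1 = of_nat p * y" using uniformizer V_1 by blast
  obtain z where z: "z \<in> V" "of_nat p * 1 = \<pi> * z" using uniformizer V_1 by blast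
  show "\<pi> \<noteq> 0" using z p_pos by auto
  then have "of_nat p / \<pi> = z"
    using z(2) by (metis mult.right_neutral nonzero_mult_div_cancel_left)
  moreover have "\<pi> / of_nat p = y"
    using y(2) p_pos by simp
  ultimately
show "of_nat p / \<pi> \<in> V" "\<pi> / of_nat p \<in> V" using y(1) z(1) by simp_all
  then show "\<pi> \<in> V" using pV_imp_V by blast
qed

end

section \<open>F is properly integral\<close>

context construction
begin

abbreviation F :: "rat poly" where "F \<equiv> F_poly \<pi> rep lift"

lemma res_prod: "(\<And>i. i \<in> I \<Longrightarrow> f i \<in> V) \<Longrightarrow> res (prod f I) = (\<Prod>i\<in>I. res (f i))"
  by (induction I rule: infinite_finite_induct) (auto simp: V_prod)

lemma res_power: "x \<in> V \<Longrightarrow> res (x ^ n) = res x ^ n"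
  by (induction n) auto

lemma res_pi [simp]: "res \<pi> = 0"
  using pi_div_p by (simp add: res_eq_0_iff)

lemma irr_no_root: assumes "f \<in> irr" shows "poly f a \<noteq> 0"
proof
  assume "poly f a = 0"
  then have dvd: "[:- a, 1:] dvd f" by (simp add: poly_eq_0_iff_dvd)
  have f: "irreducible f" "degree f = 2" using assms by (auto simp: monic_irred2_def)
  have "\<not> [:- a, 1:] dvd 1" by (simp add: poly_dvd_1)
  then have "f dvd [:- a, 1:]" using irreducibleD'[OF f(1) dvd] by blast
  from dvd_imp_degree_le[OF this] f(2) show False by simp
qed

text \<open>
  The factor \<open>h(x - b)\<close> of \<open>H\<close>, with \<open>b\<close> standing for its representative.
\<close>

definition h_shift :: "'p mod_ring \<Rightarrow> rat poly" where
  "h_shift b = lin b * (\<Prod>c\<in>UNIV - {0}. lin b * lin b + [:\<pi> * rep c:])"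

lemma pcompose_h_poly: "pcompose (h_poly \<pi> rep) (lin b) = h_shift b"
proof -
  have "pcompose [:\<pi> * rep c, 0, 1:] (lin b) = lin b * lin b + [:\<pi> * rep c:]" for c
    by (simp add: pcompose_pCons)
  moreover have "pcompose [:0, 1:] (lin b) = lin b" by (simp add: pcompose_pCons)
  ultimately show ?thesis by (simp only: h_poly_def h_shift_def pcompose_mult pcompose_prod)
qed

lemma H_eq: "H_poly \<pi> rep = (\<Prod>b\<in>UNIV. h_shift b)"
  by (simp add: H_poly_def pcompose_h_poly)

lemma lin_VX [simp]: "lin b \<in> VX" by simp

lemma h_shift_VX [simp]: "h_shift b \<in> VX"
  unfolding h_shift_def by (intro VX_mult VX_prod VX_add lin_VX) simp_all

lemma theta_VX [simp]: "theta_poly lift \<in> VX"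
  unfolding theta_poly_def by (intro VX_prod) simp

lemma F_eq:
  "F = smult ((of_nat p / \<pi>) ^ p) (smult (1 / of_nat p ^ p) (H_poly \<pi> rep * theta_poly lift ^ p))"
  using p_pos pi_nz by (simp add: F_poly_def card_p power_divide)

lemma card_nonzero: "card (UNIV - {0 :: 'p mod_ring}) = p - 1"
  using card_p by (simp add: card_Diff_subset)

text \<open>
  The factor of \<open>\<theta>\<close> that lifts the reduction of the quadratic is divisible by \<open>p\<close> modulo it, so
  \<open>\<theta> ^ p\<close> alone cancels the denominator of \<open>F\<close>.
\<close>

lemma F_in_adjoin_irreducible:
  assumes ed: "e \<in> V" "d \<in> V" and f: "f \<in> irr" "res_poly (lift f) = res_poly (quad e d)"
  shows "F \<in> adjoin (quad e d) X"
proof -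
  note rel = X_rel[OF ed]
  have VS: "g \<in> VX \<Longrightarrow> g \<in> adjoin (quad e d) X" for g
    using VX_subset_adjoin[OF rel] by simp
  have theta: "theta_poly lift = lift f * (\<Prod>g\<in>irr - {f}. lift g)"
    unfolding theta_poly_def by (rule prod.remove[OF finite_monic_irred2 f(1)])
  have "smult (1 / of_nat p) (lift f) \<in> adjoin (quad e d) X"
    using divided_by_p_in_adjoin[OF _ ed f(2)] f(1) by simp
  moreover have "(\<Prod>g\<in>irr - {f}. lift g) \<in> adjoin (quad e d) X"
    by (intro VS VX_prod) simp
  ultimately have "smult (1 / of_nat p) (theta_poly lift) \<in> adjoin (quad e d) X"
    using adjoin_mult[OF rel] unfolding theta by (metis mult_smult_left)
  then have "smult (1 / of_nat p) (theta_poly lift) ^ p \<in> adjoin (quad e d) X"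
    by (rule adjoin_power[OF rel])
  moreover have "H_poly \<pi> rep \<in> adjoin (quad e d) X"
    unfolding H_eq by (intro VS VX_prod) simp
  ultimately have "H_poly \<pi> rep * smult (1 / of_nat p) (theta_poly lift) ^ p \<in> adjoin (quad e d) X"
    using adjoin_mult[OF rel] by blast
  then have "smult (1 / of_nat p ^ p) (H_poly \<pi> rep * theta_poly lift ^ p) \<in> adjoin (quad e d) X"
    by (simp add: smult_power power_one_over)
  then show ?thesis unfolding F_eq using adjoin_smult[OF V_power[OF p_div_pi]] by blast
qed

text \<open>
  If the quadratic splits modulo \<open>p\<close>, only the factors of \<open>H\<close> that belong to its roots matter.
\<close>

lemma F_in_adjoin_of_h_factors:
  assumes rel: "\<gamma> * \<gamma> \<in> adjoin m \<gamma>" and X: "X \<in> adjoin m \<gamma>"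
    and I: "smult (1 / of_nat p ^ p) (\<Prod>b\<in>I. h_shift b) \<in> adjoin m \<gamma>"
  shows "F \<in> adjoin m \<gamma>"
proof -
  have "H_poly \<pi> rep = (\<Prod>b\<in>I. h_shift b) * (\<Prod>b\<in>UNIV - I. h_shift b)"
    unfolding H_eq by (subst prod.subset_diff[of I]) (auto simp: mult.commute)
  then have "F = smult ((of_nat p / \<pi>) ^ p) (smult (1 / of_nat p ^ p) (\<Prod>b\<in>I. h_shift b)
      * ((\<Prod>b\<in>UNIV - I. h_shift b) * theta_poly lift ^ p))"
    by (simp add: F_eq mult.assoc)
  moreover have "(\<Prod>b\<in>UNIV - I. h_shift b) * theta_poly lift ^ p \<in> adjoin m \<gamma>"
    by (intro VX_subset_adjoin[OF rel X] VX_mult VX_prod VX_power) simp_all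
  ultimately show ?thesis using adjoin_mult[OF rel I] p_div_pi by (metis V_power adjoin_smult)
qed

text \<open>
  Modulo the quadratic, \<open>K = (x - a) (x - b)\<close> is divisible by \<open>p\<close>. Pairing the factors of
  \<open>h(x - a)\<close> and \<open>h(x - b)\<close> with equal \<open>c\<close> gives \<open>((x - a)\<^sup>2 + \<pi> c) ((x - b)\<^sup>2 + \<pi> c)\<close>, which is
  \<open>K\<^sup>2\<close> up to multiples of \<open>\<pi>\<close> and hence divisible by \<open>p\<close> as well. Together with \<open>K\<close> itself
  these are \<open>p\<close> factors.
\<close>

lemma F_in_adjoin_distinct_roots:
  assumes ed: "e \<in> V" "d \<in> V" and ab: "a \<noteq> b" "res_poly (lin a * lin b) = res_poly (quad e d)"
  shows "F \<in> adjoin (quad e d) X"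
proof (rule F_in_adjoin_of_h_factors[of _ _ "{a, b}"])
  show rel: "X * X \<in> adjoin (quad e d) X" by (rule X_rel[OF ed])
  let ?S = "adjoin (quad e d) X"
  have VS: "g \<in> VX \<Longrightarrow> g \<in> ?S" for g
    using VX_subset_adjoin[OF rel] by simp
  define K where "K = lin a * lin b"
  have KV: "K \<in> VX" unfolding K_def by (rule VX_mult) simp_all
  have K: "smult (1 / of_nat p) K \<in> ?S"
    using divided_by_p_in_adjoin[OF KV ed] ab(2) by (simp only: K_def)
  define u where "u c = (lin a * lin a + [:\<pi> * rep c:]) * (lin b * lin b + [:\<pi> * rep c:])" for c
  have u: "smult (1 / of_nat p) (u c) \<in> ?S" for c
  proof -
    define k where "k = \<pi> * rep c"
    have k: "k / of_nat p \<in> V" "k \<in> V" using V_mult[OF pi_div_p rep_V[of c]] by (simp_all add: k_def)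
    have "u c = K * K + [:k:] * (lin a * lin a + lin b * lin b + [:k:])"
      unfolding u_def K_def k_def[symmetric]
      by (simp add: algebra_simps del: mult_pCons_left mult_pCons_right add_pCons)
    then have "smult (1 / of_nat p) (u c)
        = smult (1 / of_nat p) K * K + smult (k / of_nat p) (lin a * lin a + lin b * lin b + [:k:])"
      by (simp add: smult_add_right del: mult_pCons_right add_pCons)
    moreover have "lin a * lin a + lin b * lin b + [:k:] \<in> VX"
      using k by (intro VX_add VX_mult lin_VX) simp_all
    ultimately show ?thesis
      using adjoin_mult[OF rel K VS[OF KV]] adjoin_smult[OF k(1) VS] by (metis adjoin_add)
  qed
  have "(\<Prod>c\<in>{a, b}. h_shift c) = K * (\<Prod>c\<in>UNIV - {0}. u c)"
    using ab(1) unfolding h_shift_def u_def K_def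
    by (simp add: prod.distrib ac_simps del: mult_pCons_left mult_pCons_right)
  moreover have "smult (1 / of_nat p) K * smult (1 / of_nat p ^ (p - 1)) (\<Prod>c\<in>UNIV - {0}. u c) \<in> ?S"
    using adjoin_prod_divided[OF rel, of "UNIV - {0}" u] u K adjoin_mult[OF rel] by (simp only: card_nonzero)
  moreover have "(1 / of_nat p) * (1 / of_nat p ^ (p - 1)) = (1 / of_nat p ^ p :: rat)"
    using p_pos by (simp add: power_eq_if)
  ultimately show "smult (1 / of_nat p ^ p) (\<Prod>c\<in>{a, b}. h_shift c) \<in> ?S"
    by (metis mult_smult_left mult_smult_right smult_smult)
qed simp

lemma double_root_expansion:
  assumes ed: "e \<in> V" "d \<in> V" and a: "res_poly (lin a * lin a) = res_poly (quad e d)"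
  obtains d' e' where "quad e d = lin a * lin a + smult d' (lin a) + [:e':]"
    "d' / of_nat p \<in> V" "e' / of_nat p \<in> V"
proof -
  define r where "r = rep a"
  have r: "r \<in> V" "res r = a" by (simp_all add: r_def)
  have "res_poly (lin a * lin a) = [:- a, 1:] * [:- a, 1:]" by (subst res_poly_mult) simp_all
  then have "res e = a * a" "res d = - a - a"
    using a by simp_all
  then have "res (d + (r + r)) = 0" "res (e + d * r + r * r) = 0"
    using ed r by (simp_all add: algebra_simps)
  then have "(d + (r + r)) / of_nat p \<in> V" "(e + d * r + r * r) / of_nat p \<in> V"
    using ed r by (simp_all only: res_eq_0_iff V_add V_mult)
  moreover have "quad e d = lin a * lin a + smult (d + (r + r)) (lin a) + [:e + d * r + r * r:]"
    by (simp add: r_def algebra_simps)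
  ultimately show ?thesis using that by blast
qed

text \<open>
  Write the quadratic as \<open>b\<^sup>2 + d' b + e'\<close> with \<open>b = x - a\<close>, where \<open>p\<close> divides \<open>d'\<close> and \<open>e'\<close>. If
  \<open>p\<^sup>2\<close> divides \<open>e'\<close>, then \<open>b / p\<close> is integral, and all \<open>p\<close> factors of \<open>h(b)\<close> are divisible by
  \<open>p\<close> in the ring that it generates. Otherwise the quadratic is an Eisenstein polynomial in \<open>b\<close>,
  so that \<open>b\<close> has valuation one half and \<open>b\<^sup>2\<close> is close to \<open>- e'\<close>: there is exactly one \<open>c\<close> for
  which \<open>b (b\<^sup>2 + \<pi> c)\<close> is divisible by \<open>p\<^sup>2\<close>, and the \<open>p - 2\<close> other quadratic factors of \<open>h(b)\<close>
  supply the rest.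
\<close>

lemma F_in_adjoin_double_root:
  assumes ed: "e \<in> V" "d \<in> V" and a: "res_poly (lin a * lin a) = res_poly (quad e d)"
  shows "\<exists>\<gamma>. \<gamma> * \<gamma> \<in> adjoin (quad e d) \<gamma> \<and> F \<in> adjoin (quad e d) \<gamma>"
proof -
  obtain d' e' where m: "quad e d = lin a * lin a + smult d' (lin a) + [:e':]"
    and d': "d' / of_nat p \<in> V" and e': "e' / of_nat p \<in> V"
    using double_root_expansion[OF assms] .
  define b where "b = lin a"
  have m': "quad e d = b * b + smult d' b + [:e':]" using m by (simp only: b_def)
  have k: "\<pi> * rep c / of_nat p \<in> V" for c using V_mult[OF pi_div_p rep_V[of c]] by simp
  have pp: "of_nat p \<noteq> (0 :: rat)" using p_pos by simp
  show ?thesis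
  proof (cases "e' / of_nat p ^ 2 \<in> V")
    case True
    define \<gamma> where "\<gamma> = smult (1 / of_nat p) b"
    let ?S = "adjoin (quad e d) \<gamma>"
    have "\<gamma> * \<gamma> - ([:- (e' / of_nat p ^ 2):] + smult (- (d' / of_nat p)) \<gamma>)
        = smult (1 / of_nat p ^ 2) (quad e d)"
      unfolding m' \<gamma>_def
      by (simp add: smult_add_right power2_eq_square del: mult_pCons_left mult_pCons_right)
    then have rel: "\<gamma> * \<gamma> \<in> ?S"
      using True d' by (intro adjoinI[of "- (e' / of_nat p ^ 2)" "- (d' / of_nat p)"]) (simp_all del: smult_pCons add: dvd_smult)
    have "X = [:rep a:] + smult (of_nat p) \<gamma>"
      using pp by (simp add: \<gamma>_def b_def)
    then have X: "X \<in> ?S" by (metis V_of_nat adjoin_add adjoin_const adjoin_generator adjoin_smult rep_V)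
    have "smult (1 / of_nat p) (b * b + [:\<pi> * rep c:]) = smult (of_nat p) (\<gamma> * \<gamma>) + [:\<pi> * rep c / of_nat p:]" for c
      using pp by (simp add: \<gamma>_def smult_add_right)
    then have "smult (1 / of_nat p) (b * b + [:\<pi> * rep c:]) \<in> ?S" for c
      using rel k[of c] by (metis V_of_nat adjoin_add adjoin_const adjoin_smult)
    then have "\<gamma> * smult (1 / of_nat p ^ (p - 1)) (\<Prod>c\<in>UNIV - {0}. b * b + [:\<pi> * rep c:]) \<in> ?S"
      using adjoin_prod_divided[OF rel, of "UNIV - {0}" "\<lambda>c. b * b + [:\<pi> * rep c:]"] adjoin_mult[OF rel]
      by (simp only: card_nonzero adjoin_generator)
    moreover have "1 / of_nat p ^ (p - 1) * (1 / of_nat p) = (1 / of_nat p ^ p :: rat)"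
      using p_pos by (simp add: power_eq_if)
    moreover have "(\<Prod>c\<in>{a}. h_shift c) = b * (\<Prod>c\<in>UNIV - {0}. b * b + [:\<pi> * rep c:])"
      by (simp only: h_shift_def b_def prod.insert finite.emptyI empty_iff prod.empty mult_1_right not_False_eq_True)
    ultimately have "smult (1 / of_nat p ^ p) (\<Prod>c\<in>{a}. h_shift c) \<in> ?S"
      by (simp only: \<gamma>_def mult_smult_left mult_smult_right smult_smult)
    then show ?thesis using F_in_adjoin_of_h_factors[OF rel X] rel by blast
  next
    case False
    let ?S = "adjoin (quad e d) X"
    note rel = X_rel[OF ed]
    have VS: "g \<in> VX \<Longrightarrow> g \<in> ?S" for g
      using VX_subset_adjoin[OF rel] by simp
    define y where "y = e' / \<pi>"
    have y: "y \<in> V" using V_mult[OF e' p_div_pi] pp by (simp add: y_def)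
    define c0 where "c0 = res y"
    have "c0 \<noteq> 0"
    proof
      assume "c0 = 0"
      then have "y / of_nat p \<in> V" using res_eq_0_iff[OF y] by (simp add: c0_def)
      then have "(\<pi> / of_nat p) * (y / of_nat p) \<in> V" using pi_div_p by blast
      then show False using False pi_nz by (simp add: y_def power2_eq_square)
    qed
    \<comment> \<open>With \<open>c0\<close> the residue of \<open>e' / \<pi>\<close>, the constants \<open>\<pi> rep c0\<close> and \<open>e'\<close> agree modulo \<open>p\<^sup>2\<close>.\<close>
    define s where "s = (\<pi> / of_nat p) * ((rep c0 - y) / of_nat p)"
    have "res (rep c0 - y) = 0" using y by (simp add: c0_def)
    then have "(rep c0 - y) / of_nat p \<in> V" using y by (simp add: res_eq_0_iff[symmetric])
    then have s: "s \<in> V" unfolding s_def using pi_div_p by (intro V_mult)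
    have s': "\<pi> * rep c0 = e' + of_nat p ^ 2 * s"
    proof -
      have "of_nat p ^ 2 * s = \<pi> * (rep c0 - y)" using pp by (simp add: s_def power2_eq_square)
      moreover have "\<pi> * y = e'" using pi_nz by (simp add: y_def)
      ultimately show ?thesis by (simp add: right_diff_distrib)
    qed
    define v where "v c = b * b + [:\<pi> * rep c:]" for c
    have bV: "b \<in> VX" by (simp add: b_def)
    define D E where "D = d' / of_nat p" and "E = e' / of_nat p"
    have DE: "D \<in> V" "E \<in> V" "d' = of_nat p * D" "e' = of_nat p * E"
      using d' e' pp by (simp_all add: D_def E_def)
    have "b * v c0 = smult (of_nat p ^ 2) (smult (D * D) b + [:D * E:] + smult s b)
        + quad e d * (b - [:d':])"
      unfolding v_def s' m' DE(3,4) power2_eq_square const_poly_hom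
      by (simp add: algebra_simps del: mult_pCons_left mult_pCons_right add_pCons diff_pCons minus_pCons)
    then have "smult (1 / of_nat p ^ 2) (b * v c0)
        = (smult (D * D) b + [:D * E:] + smult s b) + quad e d * smult (1 / of_nat p ^ 2) (b - [:d':])"
      using pp by (simp only: smult_add_right smult_smult mult_smult_right) simp
    moreover have "smult (D * D) b + [:D * E:] + smult s b \<in> VX"
      using DE(1,2) s bV by (intro VX_add VX_smult) simp_all
    ultimately have "smult (1 / of_nat p ^ 2) (b * v c0) \<in> ?S"
      using VS adjoin_dvd[OF dvd_triv_left] by (metis adjoin_add)
    moreover have "smult (1 / of_nat p) (v c) \<in> ?S" for c
    proof -
      have bb: "b * b \<in> VX" unfolding b_def by (intro VX_mult) simp_all
      have "smult (1 / of_nat p) (b * b) \<in> ?S"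
        using divided_by_p_in_adjoin[OF bb ed] a by (simp only: b_def)
      moreover have "smult (1 / of_nat p) (v c) = smult (1 / of_nat p) (b * b) + [:\<pi> * rep c / of_nat p:]"
        by (simp add: v_def smult_add_right)
      ultimately show ?thesis using k[of c] by (metis adjoin_add adjoin_const)
    qed
    ultimately have "smult (1 / of_nat p ^ 2) (b * v c0) *
        smult (1 / of_nat p ^ card (UNIV - {0, c0})) (\<Prod>c\<in>UNIV - {0, c0}. v c) \<in> ?S"
      using adjoin_prod_divided[OF rel, of "UNIV - {0, c0}" v] adjoin_mult[OF rel] by metis
    moreover have "card (UNIV - {0, c0}) = p - 2"
      using \<open>c0 \<noteq> 0\<close> card_p by (simp add: card_Diff_subset)
    moreover have "1 / of_nat p ^ (p - 2) * (1 / of_nat p ^ 2) = (1 / of_nat p ^ p :: rat)"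
    proof -
      have "of_nat p ^ (p - 2) * of_nat p ^ 2 = (of_nat p ^ p :: rat)"
        by (metis power_add le_add_diff_inverse2 p_ge2)
      then show ?thesis by simp
    qed
    moreover have "h_shift a = b * v c0 * (\<Prod>c\<in>UNIV - {0, c0}. v c)"
    proof -
      have "UNIV - {0} - {c0} = UNIV - {0, c0}" by auto
      then show ?thesis
        unfolding h_shift_def b_def[symmetric] v_def[symmetric]
        using prod.remove[of "UNIV - {0}" c0 v] \<open>c0 \<noteq> 0\<close> by (simp add: mult.assoc)
    qed
    ultimately have "smult (1 / of_nat p ^ p) (\<Prod>c\<in>{a}. h_shift c) \<in> ?S"
      by (simp only: mult_smult_left mult_smult_right smult_smult prod.insert finite.emptyI empty_iff
          prod.empty mult_1_right not_False_eq_True)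
    then show ?thesis using F_in_adjoin_of_h_factors[OF rel adjoin_generator] rel by blast
  qed
qed

lemma F_integral: "to_fract F \<in> integral_closure_of (to_fract ` Int_M2 p)"
proof (rule quadratic_imp_integral)
  fix e d assume ed: "e \<in> V" "d \<in> V"
  have "\<exists>\<gamma>. \<gamma> * \<gamma> \<in> adjoin (quad e d) \<gamma> \<and> F \<in> adjoin (quad e d) \<gamma>"
    using ed
  proof (cases rule: residue_cases)
    case (irreducible f)
    then show ?thesis using F_in_adjoin_irreducible[OF ed] X_rel[OF ed] by blast
  next
    case (split a b)
    show ?thesis
    proof (cases "a = b")
      case True
      then show ?thesis using F_in_adjoin_double_root[OF ed] split by blast
    next
      case False
      then show ?thesis using F_in_adjoin_distinct_roots[OF ed False split] X_rel[OF ed] by blast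
    qed
  qed
  then show "\<exists>T\<in>V. \<exists>E\<in>V. quad e d dvd F * F - smult T F + [:E:]"
    using adjoin_quadratic by blast
qed

text \<open>
  The witness is the square of \<open>x - r\<close>, where \<open>r\<close> represents \<open>0\<close>. Modulo it, \<open>F\<close> is a multiple
  of \<open>x - r\<close> by the value at \<open>r\<close> of the complementary factor \<open>G\<close> divided by \<open>\<pi> ^ p\<close>. That value
  has only \<open>p - 1\<close> factors \<open>\<pi>\<close>, since all other factors of \<open>G\<close> are units at \<open>r\<close>.
\<close>

lemma F_notin_Int: "F \<notin> Int_M2 p"
proof
  assume F: "F \<in> Int_M2 p"
  define r where "r = rep 0"
  have r: "r \<in> V" "res r = 0" by (simp_all add: r_def)
  define G where "G = (\<Prod>c\<in>UNIV - {0}. lin 0 * lin 0 + [:\<pi> * rep c:]) * (\<Prod>b\<in>UNIV - {0}. h_shift b) * theta_poly lift ^ p"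
  have FG: "F = smult (1 / \<pi> ^ p) (lin 0 * G)"
    unfolding F_poly_def card_p H_eq G_def prod.remove[of UNIV "0 :: 'p mod_ring" h_shift, simplified] h_shift_def[of 0]
    by (simp only: mult.assoc)
  have "[:- r, 1:] dvd G - [:poly G r:]" by (simp add: poly_eq_0_iff_dvd[symmetric])
  then obtain q where q: "G - [:poly G r:] = [:- r, 1:] * q" by auto
  have "[:- r * (poly G r / \<pi> ^ p), poly G r / \<pi> ^ p:] = smult (1 / \<pi> ^ p) ([:- r, 1:] * [:poly G r:])"
    by simp
  then have "F - [:- r * (poly G r / \<pi> ^ p), poly G r / \<pi> ^ p:]
      = smult (1 / \<pi> ^ p) ([:- r, 1:] * (G - [:poly G r:]))"
    by (simp only: FG r_def smult_diff_right right_diff_distrib)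
  also have "\<dots> = smult (1 / \<pi> ^ p) (quad (r * r) (- 2 * r) * q)"
    unfolding q mult.assoc[symmetric] by simp
  also have "\<dots> = quad (r * r) (- 2 * r) * smult (1 / \<pi> ^ p) q"
    by (simp only: mult_smult_right)
  finally have "F mod quad (r * r) (- 2 * r) = [:- r * (poly G r / \<pi> ^ p), poly G r / \<pi> ^ p:]"
    by (intro mod_quad_eqI dvdI)
  moreover have "F mod quad (r * r) (- 2 * r) \<in> VX"
    using F r unfolding Int_M2_iff adjoin_quad_X_iff[symmetric] by auto
  ultimately have Gr: "poly G r / \<pi> ^ p \<in> V" by simp
  define U where "U = (\<Prod>c\<in>UNIV - {0}. rep c) * poly ((\<Prod>b\<in>UNIV - {0}. h_shift b) * theta_poly lift ^ p) r"
  have "poly G r = \<pi> ^ (p - 1) * U"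
  proof -
    have "poly (\<Prod>c\<in>UNIV - {0}. lin 0 * lin 0 + [:\<pi> * rep c:]) r = (\<Prod>c\<in>UNIV - {0}. \<pi> * rep c)"
      unfolding poly_prod by (intro prod.cong refl) (simp add: r_def)
    also have "\<dots> = \<pi> ^ (p - 1) * (\<Prod>c\<in>UNIV - {0}. rep c)"
      by (simp only: prod.distrib prod_constant card_nonzero)
    finally show ?thesis unfolding G_def U_def by (simp only: poly_mult mult.assoc)
  qed
  moreover have "\<pi> ^ p = \<pi> ^ (p - 1) * \<pi>"
    by (metis p_pos power_minus_mult)
  ultimately have "poly G r / \<pi> ^ p * (\<pi> / of_nat p) = U / of_nat p"
    using pi_nz by simp
  then have Up: "U / of_nat p \<in> V" using V_mult[OF Gr pi_div_p] by (simp only:)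
  have poly_h_shift: "poly (h_shift b) r \<in> V" for b by (rule VX_poly[OF h_shift_VX r(1)])
  have poly_lift: "poly (lift f) r \<in> V" if "f \<in> irr" for f
    by (rule VX_poly[OF lift_props(1)[OF that] r(1)])
  have U_eq: "U = (\<Prod>c\<in>UNIV - {0}. rep c) * (\<Prod>b\<in>UNIV - {0}. poly (h_shift b) r)
      * (\<Prod>f\<in>irr. poly (lift f) r) ^ p"
    by (simp add: U_def poly_prod theta_poly_def mult.assoc)
  have "res (poly (h_shift b) r) \<noteq> 0" if "b \<noteq> 0" for b
  proof -
    have "res (poly (h_shift b) r) = - b * (\<Prod>c\<in>UNIV - {0 :: 'p mod_ring}. b * b)"
      by (simp add: h_shift_def poly_prod res_prod V_prod r)
    then show ?thesis using that by simp
  qed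
  moreover have "res (poly (lift f) r) \<noteq> 0" if "f \<in> irr" for f
    using that irr_no_root[of f 0] poly_res_poly[of "lift f" r] r by simp
  ultimately have "res U \<noteq> 0"
    using poly_h_shift poly_lift finite_monic_irred2[where 'p = 'p] unfolding U_eq
    by (simp add: res_prod res_power V_prod)
  moreover have "U \<in> V" using Up pV_imp_V by blast
  ultimately show False using Up res_eq_0_iff by blast
qed

end

section \<open>Divisors, expansions and norms\<close>

text \<open>
  For each \<open>i\<close> the coefficients of degree \<open>i\<close> of the remainders of the \<open>u k\<close> modulo \<open>f\<close> are the
  coefficients of a polynomial in \<open>c\<close> of degree below \<open>n\<close> that has at least \<open>n\<close> roots. Below,
  \<open>f\<close> is irreducible or the square of a linear polynomial.
\<close>

lemma dvd_coefficients_of_vandermonde: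
  fixes f :: "'a::field poly"
  assumes C: "finite C" "n \<le> card C"
    and dvd: "\<And>c. c \<in> C \<Longrightarrow> f dvd (\<Sum>k<n. smult (c ^ k) (u k))"
    and k: "k < n"
  shows "f dvd u k"
proof -
  have "coeff (u k mod f) i = 0" for i
  proof -
    define P where "P = (\<Sum>k<n. monom (coeff (u k mod f) i) k)"
    have coeffP: "coeff P j = (if j < n then coeff (u j mod f) i else 0)" for j
      by (simp add: P_def coeff_sum)
    have "poly P c = 0" if "c \<in> C" for c
    proof -
      have "poly P c = coeff ((\<Sum>k<n. smult (c ^ k) (u k)) mod f) i"
        by (simp add: P_def poly_sum poly_monom mod_poly_sum coeff_sum mod_smult_left mult.commute)
      then show ?thesis using dvd[OF that] by (simp add: dvd_imp_mod_0)
    qed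
    then have sub: "C \<subseteq> {c. poly P c = 0}" by auto
    have "P = 0"
    proof (rule ccontr)
      assume P: "P \<noteq> 0"
      have "card C \<le> card {c. poly P c = 0}" using sub poly_roots_finite[OF P] by (rule card_mono[rotated])
      also have "\<dots> \<le> degree P" using P by (rule card_poly_roots_bound)
      also have "degree P < n" using k by (intro degree_lessI) (auto simp: coeffP)
      finally show False using C by simp
    qed
    then show ?thesis using coeffP[of k] k by simp
  qed
  then have "u k mod f = 0" by (intro poly_eqI) simp
  then show ?thesis by (simp add: mod_eq_0_iff_dvd)
qed

lemma prod_dvd_of_coprime:
  fixes q :: "'i \<Rightarrow> 'a::semiring_gcd"
  assumes "\<And>i j. i \<in> I \<Longrightarrow> j \<in> I \<Longrightarrow> i \<noteq> j \<Longrightarrow> coprime (q i) (q j)"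
    and "\<And>i. i \<in> I \<Longrightarrow> q i dvd s"
  shows "prod q I dvd s"
  using assms
proof (induction I rule: infinite_finite_induct)
  case (insert i I)
  have "coprime (q i) (prod q I)"
    using insert by (intro prod_coprime_right) auto
  then show ?case using insert by (simp add: divides_mult)
qed auto

text \<open>
  Repeated division with remainder by \<open>\<Phi>\<close>.
\<close>

lemma adic_expansion:
  fixes g \<Phi> :: "'a::field poly"
  assumes "degree g < n * degree \<Phi>"
  shows "\<exists>r. g = (\<Sum>k<n. r k * \<Phi> ^ k) \<and> (\<forall>k<n. degree (r k) < degree \<Phi>)"
  using assms
proof (induction n arbitrary: g)
  case 0
  then show ?case by simp
next
  case (Suc n)
  define q where "q = g div \<Phi>"
  have D: "degree \<Phi> > 0" "\<Phi> \<noteq> 0" using Suc.prems by (auto intro: Nat.gr0I)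
  have g: "g = q * \<Phi> + g mod \<Phi>" by (simp add: q_def)
  have r: "degree (g mod \<Phi>) < degree \<Phi>" using D by (metis degree_0 degree_mod_less')
  show ?case
  proof (cases "q = 0")
    case True
    then have "g = (\<Sum>k<Suc n. (if k = 0 then g else 0) * \<Phi> ^ k)"
      by (simp add: sum.lessThan_Suc_shift del: sum.lessThan_Suc)
    moreover have "degree g < degree \<Phi>" using g r True by simp
    ultimately show ?thesis using D by (intro exI[of _ "\<lambda>k. if k = 0 then g else 0"]) auto
  next
    case False
    then have "degree (q * \<Phi>) = degree q + degree \<Phi>" using D by (simp add: degree_mult_eq)
    moreover from this have "degree g = degree (q * \<Phi>)"
      using r by (subst g, intro degree_add_eq_left) simp
    ultimately have "degree q < n * degree \<Phi>" using Suc.prems by simp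
    from Suc.IH[OF this] obtain s where s: "q = (\<Sum>k<n. s k * \<Phi> ^ k)" "\<forall>k<n. degree (s k) < degree \<Phi>"
      by blast
    define t where "t k = (case k of 0 \<Rightarrow> g mod \<Phi> | Suc j \<Rightarrow> s j)" for k
    have "g = (\<Sum>k<Suc n. t k * \<Phi> ^ k)"
      by (subst g) (simp add: s(1) t_def sum.lessThan_Suc_shift sum_distrib_left algebra_simps del: sum.lessThan_Suc)
    moreover have "\<forall>k<Suc n. degree (t k) < degree \<Phi>"
      using s(2) r by (auto simp: t_def split: nat.splits)
    ultimately show ?thesis by blast
  qed
qed

text \<open>
  If the degree of \<open>g\<close> stays \<open>j\<close> below the general bound, the whole gain falls to the leading
  digit: the lower terms cannot cancel its leading coefficient.
\<close>

lemma adic_expansion_top: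
  fixes g \<Phi> :: "'a::field poly"
  assumes g: "degree g < Suc n * degree \<Phi> - j" and j: "j < degree \<Phi>"
  shows "\<exists>r. g = (\<Sum>k<Suc n. r k * \<Phi> ^ k) \<and> (\<forall>k<Suc n. degree (r k) < degree \<Phi>)
    \<and> degree (r n) < degree \<Phi> - j"
proof -
  have "degree g < Suc n * degree \<Phi>" using g by linarith
  from adic_expansion[OF this] obtain r
    where r: "g = (\<Sum>k<Suc n. r k * \<Phi> ^ k)" "\<forall>k<Suc n. degree (r k) < degree \<Phi>" by blast
  have nz: "\<Phi> \<noteq> 0" using j by auto
  have "degree (r n) < degree \<Phi> - j"
  proof (cases "r n = 0")
    case True
    then show ?thesis using j by simp
  next
    case False
    have top: "degree (r n * \<Phi> ^ n) = degree (r n) + n * degree \<Phi>"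
      using False nz by (simp add: degree_mult_eq degree_power_eq)
    have low: "degree (\<Sum>k<n. r k * \<Phi> ^ k) < degree (r n * \<Phi> ^ n) \<or> (\<Sum>k<n. r k * \<Phi> ^ k) = 0"
    proof (cases "n = 0")
      case False
      have "degree (r k * \<Phi> ^ k) < n * degree \<Phi>" if "k < n" for k
      proof -
        have "degree (r k * \<Phi> ^ k) \<le> degree (r k) + degree (\<Phi> ^ k)" by (rule degree_mult_le)
        also have "degree (\<Phi> ^ k) = k * degree \<Phi>" using nz by (simp add: degree_power_eq)
        also have "degree (r k) + k * degree \<Phi> < Suc k * degree \<Phi>" using r(2) that by simp
        also have "\<dots> \<le> n * degree \<Phi>" using that by (intro mult_right_mono) auto
        finally show ?thesis .
      qed
      then have "degree (\<Sum>k<n. r k * \<Phi> ^ k) < n * degree \<Phi>"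
        using False j by (intro degree_sum_less) auto
      then show ?thesis using top by simp
    qed simp
    have "degree g = degree (r n * \<Phi> ^ n)"
      using low unfolding r(1) by (auto simp: degree_add_eq_right)
    then show ?thesis using top g by simp
  qed
  then show ?thesis using r by blast
qed

context localization
begin

lemma monic_quadratic_division:
  assumes ed: "e \<in> V" "d \<in> V" and "f \<in> VX"
  shows "\<exists>q\<in>VX. \<exists>a b. f = quad e d * q + [:a, b:]"
  using assms(3)
proof (induction f rule: pCons_induct)
  case 0
  show ?case by (intro bexI[of _ 0] exI[of _ 0]) auto
next
  case (pCons c f)
  then obtain q a b where q: "q \<in> VX" "f = quad e d * q + [:a, b:]" by auto
  have "b \<in> V"
  proof -
    have "f mod quad e d = [:a, b:]" by (rule mod_quad_eqI) (simp only: q(2) add_diff_cancel_right' dvd_triv_left)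
    moreover have "f mod quad e d \<in> VX"
      using VX_subset_adjoin[OF X_rel[OF ed] adjoin_generator, of f] pCons(2,3) adjoin_quad_X_iff by auto
    ultimately show ?thesis by simp
  qed
  have "pCons c f = quad e d * (X * q + [:b:]) + [:c - b * e, a - b * d:]"
    unfolding q(2) by (simp add: algebra_simps)
  moreover have "X * q + [:b:] \<in> VX" using q(1) \<open>b \<in> V\<close> by (intro VX_add VX_mult) simp_all
  ultimately show ?case by blast
qed

lemma quad_norm_cong: "quad e d dvd f - g \<Longrightarrow> quad_norm e d f = quad_norm e d g"
  by (simp add: quad_norm_def mod_eq_dvd_iff[symmetric])

text \<open>
  The norm of \<open>w0 + w1 X\<close> is \<open>w1\<^sup>2\<close> times the value of the quadratic at \<open>- w0 / w1\<close>. If \<open>w1\<close>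
  were a unit, divisibility of the norm by \<open>p\<^sup>2\<close> would produce a root modulo \<open>p\<^sup>2\<close>. So \<open>p\<close>
  divides \<open>w1\<close>, and then also \<open>w0\<^sup>2\<close>.
\<close>

lemma divisible_of_quad_norm:
  assumes ed: "e \<in> V" "d \<in> V" and W: "W \<in> VX"
    and norm: "quad_norm e d W / of_nat p ^ 2 \<in> V"
    and no_root: "\<And>s. s \<in> V \<Longrightarrow> poly (quad e d) s / of_nat p ^ 2 \<notin> V"
  shows "smult (1 / of_nat p) W \<in> adjoin (quad e d) X"
proof -
  have "W \<in> adjoin (quad e d) X"
    using VX_subset_adjoin[OF X_rel[OF ed]] W by simp
  then obtain w0 w1 where w: "w0 \<in> V" "w1 \<in> V" "quad e d dvd W - ([:w0:] + smult w1 X)"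
    by (auto simp: adjoin_def)
  then have n: "quad_norm e d W = w0 * w0 - d * w0 * w1 + e * w1 * w1"
    by (intro quad_normI) simp
  have w1: "w1 / of_nat p \<in> V"
  proof (rule ccontr)
    assume "w1 / of_nat p \<notin> V"
    then have u: "1 / w1 \<in> V" "w1 \<noteq> 0" using V_unit[OF w(2)] by auto
    have "poly (quad e d) (- (w0 * (1 / w1))) = quad_norm e d W * (1 / w1) * (1 / w1)"
      unfolding n using u(2) by (simp add: field_simps)
    then have "poly (quad e d) (- (w0 * (1 / w1))) / of_nat p ^ 2
        = (quad_norm e d W / of_nat p ^ 2) * (1 / w1) * (1 / w1)" by simp
    also have "\<dots> \<in> V" using norm u(1) by (intro V_mult)
    finally show False using no_root[of "- (w0 * (1 / w1))"] w(1) u(1) by blast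
  qed
  have pp: "of_nat p \<noteq> (0 :: rat)" using p_pos by simp
  have "w0 ^ 2 / of_nat p = of_nat p * (quad_norm e d W / of_nat p ^ 2)
      + d * w0 * (w1 / of_nat p) - e * w1 * (w1 / of_nat p)"
    unfolding n using pp by (simp add: field_simps power2_eq_square)
  also have "\<dots> \<in> V" using norm ed w w1 by (intro V_add V_diff V_mult) simp_all
  finally have w0: "w0 / of_nat p \<in> V" using pV_power[OF w(1)] by blast
  have "smult (1 / of_nat p) W - ([:w0 / of_nat p:] + smult (w1 / of_nat p) X)
      = smult (1 / of_nat p) (W - ([:w0:] + smult w1 X))"
    by (simp add: smult_diff_right)
  then show ?thesis using w0 w1 w(3) by (intro adjoinI[of "w0 / of_nat p" "w1 / of_nat p"]) (simp_all only: dvd_smult)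
qed

end

section \<open>A polynomial divisible by p at every matrix\<close>

context construction
begin

text \<open>
  The reduction of \<open>Phi\<close> is the least common multiple of all monic quadratics over the residue
  field, so that \<open>Phi / p\<close> is integer-valued.
\<close>

definition Phi :: "rat poly" where
  "Phi = (\<Prod>a\<in>UNIV. lin a * lin a) * theta_poly lift"

lemma theta_degree: "degree (theta_poly lift) = 2 * card irr" and theta_nz: "theta_poly lift \<noteq> 0"
proof -
  show "theta_poly lift \<noteq> 0"
    unfolding theta_poly_def using finite_monic_irred2[where 'p = 'p] by simp
  have "degree (theta_poly lift) = (\<Sum>f\<in>irr. degree (lift f))"
    unfolding theta_poly_def by (rule degree_prod_eq_sum_degree) simp
  then show "degree (theta_poly lift) = 2 * card irr" by simp
qed

lemma Phi_degree: "degree Phi = 2 * p + 2 * card irr"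
proof -
  have "degree (\<Prod>a\<in>UNIV. lin a * lin a) = (\<Sum>a\<in>(UNIV :: 'p mod_ring set). degree (lin a * lin a))"
    by (rule degree_prod_eq_sum_degree) simp
  also have "\<dots> = 2 * p" using card_p by (simp add: degree_mult_eq del: mult_pCons_left mult_pCons_right)
  finally show ?thesis
    unfolding Phi_def using theta_nz theta_degree by (subst degree_mult_eq) (auto simp del: mult_pCons_left mult_pCons_right)
qed

text \<open>
  The factor \<open>\<theta> ^ p\<close> is common to \<open>F\<close> and \<open>Phi ^ p\<close>, so the difference of the degrees is the one
  between \<open>p (2 p)\<close> and the degree \<open>p (2 p - 1)\<close> of \<open>H\<close>.
\<close>

lemma F_degree: "degree F = p * degree Phi - p"
proof -
  have quad_deg: "degree (lin b * lin b + [:c:]) = 2" for b c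
    by (simp add: degree_pCons_eq_if)
  have quad_nz: "lin b * lin b + [:c:] \<noteq> 0" for b c
    using quad_deg[of b c] by auto
  have h_shift: "h_shift b \<noteq> 0" "degree (h_shift b) = 2 * p - 1" for b
  proof -
    show "h_shift b \<noteq> 0" unfolding h_shift_def using quad_nz by (simp del: mult_pCons_left mult_pCons_right)
    have "degree (\<Prod>c\<in>UNIV - {0}. lin b * lin b + [:\<pi> * rep c:])
        = (\<Sum>c\<in>UNIV - {0 :: 'p mod_ring}. degree (lin b * lin b + [:\<pi> * rep c:]))"
      by (rule degree_prod_eq_sum_degree) (use quad_nz in blast)
    also have "\<dots> = 2 * (p - 1)" by (simp only: quad_deg) (simp add: card_nonzero)
    finally show "degree (h_shift b) = 2 * p - 1"
      unfolding h_shift_def using quad_nz p_ge2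
      by (subst degree_mult_eq) (auto simp del: mult_pCons_left mult_pCons_right)
  qed
  have "degree (H_poly \<pi> rep) = (\<Sum>b\<in>(UNIV :: 'p mod_ring set). degree (h_shift b))"
    unfolding H_eq by (rule degree_prod_eq_sum_degree) (use h_shift(1) in blast)
  also have "\<dots> = p * (2 * p - 1)" using h_shift(2) card_p by simp
  finally have H: "degree (H_poly \<pi> rep) = p * (2 * p - 1)" .
  have "H_poly \<pi> rep \<noteq> 0" unfolding H_eq using h_shift(1) by simp
  then have "degree F = p * (2 * p - 1) + p * (2 * card irr)"
    using theta_nz pi_nz H theta_degree by (simp add: F_poly_def card_p degree_mult_eq degree_power_eq)
  then show ?thesis by (simp add: Phi_degree diff_mult_distrib2 add_mult_distrib2)
qed

lemma Phi_split_double: "Phi = (lin a * lin a) * ((\<Prod>b\<in>UNIV - {a}. lin b * lin b) * theta_poly lift)"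
  unfolding Phi_def using prod.remove[of UNIV a "\<lambda>b. lin b * lin b"] by (simp only: finite UNIV_I mult.assoc)

lemma Phi_split_irr:
  assumes "f \<in> irr"
  shows "Phi = lift f * ((\<Prod>a\<in>UNIV. lin a * lin a) * (\<Prod>g\<in>irr - {f}. lift g))"
  unfolding Phi_def theta_poly_def prod.remove[OF finite_monic_irred2 assms] by (simp only: ac_simps)

lemma Phi_over_p_in_Int: "smult (1 / of_nat p) Phi \<in> Int_M2 p"
  unfolding Int_M2_iff
proof (intro ballI)
  fix e d assume ed: "e \<in> V" "d \<in> V"
  have "\<exists>K G. K \<in> VX \<and> G \<in> VX \<and> res_poly K = res_poly (quad e d) \<and> Phi = K * G"
    using ed
  proof (cases rule: residue_cases)
    case (irreducible f)
    have "(\<Prod>a\<in>UNIV. lin a * lin a) * (\<Prod>g\<in>irr - {f}. lift g) \<in> VX"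
      by (intro VX_mult VX_prod lin_VX) simp
    then show ?thesis using irreducible Phi_split_irr[of f] lift_props(1) by blast
  next
    case (split a b)
    have "Phi = (lin a * lin b) * ((\<Prod>c\<in>UNIV - {a}. lin c) * (\<Prod>c\<in>UNIV - {b}. lin c) * theta_poly lift)"
      unfolding Phi_def prod.distrib
      using prod.remove[of UNIV a lin] prod.remove[of UNIV b lin] by (simp only: finite UNIV_I ac_simps)
    moreover have "(\<Prod>c\<in>UNIV - {a}. lin c) * (\<Prod>c\<in>UNIV - {b}. lin c) * theta_poly lift \<in> VX"
      by (intro VX_mult VX_prod theta_VX lin_VX)
    moreover have "lin a * lin b \<in> VX" by (intro VX_mult lin_VX)
    ultimately show ?thesis using split by blast
  qed
  then obtain K G where KG: "K \<in> VX" "G \<in> VX" "res_poly K = res_poly (quad e d)" "Phi = K * G" by blast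
  have "smult (1 / of_nat p) K * G \<in> adjoin (quad e d) X"
    using divided_by_p_in_adjoin[OF KG(1) ed KG(3)] VX_subset_adjoin[OF X_rel[OF ed] adjoin_generator KG(2)]
    by (rule adjoin_mult[OF X_rel[OF ed]])
  then show "smult (1 / of_nat p) Phi \<in> adjoin (quad e d) X" by (simp add: KG(4))
qed

lemma monic_irr_dvd_imp_eq:
  assumes "f \<in> irr" "g \<in> irr" "f dvd g"
  shows "f = g"
proof -
  have fg: "degree f = 2" "lead_coeff f = 1" "degree g = 2" "lead_coeff g = 1"
    using assms by (auto simp: monic_irred2_def)
  obtain h where h: "g = f * h" using assms(3) by (rule dvdE)
  have nz: "f \<noteq> 0" "h \<noteq> 0" using h fg by auto
  then have "degree h = 0" using fg h by (simp add: degree_mult_eq)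
  moreover have "lead_coeff g = lead_coeff f * lead_coeff h" unfolding h by (rule lead_coeff_mult)
  then have "lead_coeff h = 1" using fg(2,4) by (simp only: mult_1_left)
  ultimately have "h = 1" by (metis degree_0_id lead_coeff_pCons(1) one_pCons)
  then show ?thesis using h by simp
qed

lemma irr_prime_elem: "f \<in> irr \<Longrightarrow> prime_elem f"
  by (rule irreducible_imp_prime_elem) (simp add: monic_irred2_def)

lemma coprime_irr: "f \<in> irr \<Longrightarrow> g \<in> irr \<Longrightarrow> f \<noteq> g \<Longrightarrow> coprime f g"
  using monic_irr_dvd_imp_eq irr_prime_elem prime_elem_imp_coprime by blast

lemma coprime_irr_linear: "f \<in> irr \<Longrightarrow> coprime f [:- a, 1:]"
  and coprime_linear_irr: "f \<in> irr \<Longrightarrow> coprime [:- a, 1:] f"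
proof -
  assume f: "f \<in> irr"
  have "\<not> f dvd [:- a, 1:]"
  proof
    assume "f dvd [:- a, 1:]"
    from dvd_imp_degree_le[OF this] f show False by (simp add: monic_irred2_def)
  qed
  then show "coprime f [:- a, 1:]" using f irr_prime_elem prime_elem_imp_coprime by blast
  then show "coprime [:- a, 1:] f" by (simp add: coprime_commute)
qed

lemma coprime_linear: "a \<noteq> b \<Longrightarrow> coprime [:- a, 1:] [:- b, 1 :: 'p mod_ring:]"
proof (rule coprimeI)
  fix k :: "'p mod_ring poly" assume ab: "a \<noteq> b" and k: "k dvd [:- a, 1:]" "k dvd [:- b, 1:]"
  have "k dvd [:- a, 1:] - [:- b, 1:]" using k by (rule dvd_diff)
  then have "k dvd [:b - a:]" by simp
  moreover have "[:b - a:] dvd 1" using ab by (simp add: is_unit_const_poly_iff dvd_field_iff)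
  ultimately show "k dvd 1" by (rule dvd_trans)
qed

lemma eq_0_of_divisors:
  assumes lin: "\<And>a. [:- a, 1:] ^ n dvd s" and irr: "\<And>f. f \<in> irr \<Longrightarrow> f dvd s"
    and deg: "degree s < n * p + 2 * card irr"
  shows "s = (0 :: 'p mod_ring poly)"
proof (rule ccontr)
  assume s: "s \<noteq> 0"
  let ?P = "(\<Prod>a\<in>UNIV. [:- a, 1:] ^ n) :: 'p mod_ring poly" and ?Q = "\<Prod>f\<in>irr. f"
  have "?P dvd s"
    by (rule prod_dvd_of_coprime) (auto intro!: lin coprime_linear)
  moreover have "?Q dvd s"
    by (rule prod_dvd_of_coprime) (auto intro!: irr coprime_irr)
  moreover have "coprime ?P ?Q"
    by (intro prod_coprime_left prod_coprime_right) (auto intro!: coprime_linear_irr)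
  ultimately have "?P * ?Q dvd s" by (rule divides_mult)
  then have "degree (?P * ?Q) \<le> degree s" using s by (rule dvd_imp_degree_le)
  moreover have deg2: "degree f = 2" if "f \<in> irr" for f using that by (auto simp: monic_irred2_def)
  then have "0 \<notin> irr" by fastforce
  then have "?Q \<noteq> 0" using finite_monic_irred2[where 'p = 'p] by simp
  moreover have "degree ?Q = 2 * card irr"
    using \<open>0 \<notin> irr\<close> deg2 by (subst degree_prod_eq_sum_degree) auto
  moreover have "degree ?P = n * p"
    using card_p by (subst degree_prod_eq_sum_degree) (auto simp: degree_power_eq)
  ultimately show False using deg by (simp add: degree_mult_eq)
qed

end

section \<open>Integral polynomials of small degree are integer-valued\<close>

lemma diff_dvd_power_diff: "x - y dvd x ^ n - (y :: 'a::comm_ring_1) ^ n"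
  by (cases n) (simp_all only: power_diff_sumr2 dvd_triv_left power_0 diff_self dvd_0_right)

context construction
begin

text \<open>
  Modulo the quadratic \<open>m = quad e d + p c\<close> the polynomial \<open>Phi / p = quad e d \<Psi> / p\<close> is
  congruent to \<open>- c \<Psi>\<close>, which does not involve \<open>p\<close> any more. So an expansion of \<open>p ^ (N + 1) g\<close>
  in powers of \<open>Phi / p\<close> turns into a polynomial in \<open>\<Psi>\<close>, and the integrality of the norm of \<open>g\<close>
  into divisibility by \<open>p\<^sup>2\<close>.
\<close>

lemma norm_of_substitution:
  assumes norm: "\<And>e d. e \<in> V \<Longrightarrow> d \<in> V \<Longrightarrow> quad_norm e d g \<in> V"
    and g: "smult (of_nat p ^ Suc N) g = (\<Sum>k<n. S k * smult (1 / of_nat p) Phi ^ k)"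
    and ed: "e \<in> V" "d \<in> V" "c \<in> V" and Phi: "Phi = quad e d * \<Psi>"
  shows "quad_norm (e + of_nat p * c) d (\<Sum>k<n. S k * smult (- c) \<Psi> ^ k) / of_nat p ^ 2 \<in> V"
proof -
  let ?m = "quad (e + of_nat p * c) d"
  define W where "W = (\<Sum>k<n. S k * smult (- c) \<Psi> ^ k)"
  have pp: "of_nat p \<noteq> (0 :: rat)" using p_pos by simp
  have "?m = quad e d + [:of_nat p * c:]" by simp
  then have "smult (1 / of_nat p) Phi - smult (- c) \<Psi> = ?m * smult (1 / of_nat p) \<Psi>"
    unfolding Phi using pp
    by (simp add: distrib_right smult_add_right del: mult_pCons_left add_pCons) simp
  then have "?m dvd smult (1 / of_nat p) Phi ^ k - smult (- c) \<Psi> ^ k" for k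
    using diff_dvd_power_diff by (metis dvd_mult_left)
  then have "?m dvd (\<Sum>k<n. S k * (smult (1 / of_nat p) Phi ^ k - smult (- c) \<Psi> ^ k))"
    by (intro dvd_sum dvd_mult)
  then have "?m dvd smult (of_nat p ^ Suc N) g - W"
    unfolding g W_def by (simp add: right_diff_distrib sum_subtractf)
  then have "quad_norm (e + of_nat p * c) d W = quad_norm (e + of_nat p * c) d (smult (of_nat p ^ Suc N) g)"
    by (rule quad_norm_cong[symmetric])
  also have "\<dots> / of_nat p ^ 2 = of_nat p ^ N * of_nat p ^ N * quad_norm (e + of_nat p * c) d g"
    unfolding quad_norm_smult using pp by (simp add: power2_eq_square)
  also have "\<dots> \<in> V" using norm[of "e + of_nat p * c" d] ed by (intro V_mult V_power) simp_all
  finally show ?thesis by (simp only: W_def)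
qed

lemma res_poly_prod_double_linear:
  "res_poly (\<Prod>a\<in>A. lin a * lin a) = (\<Prod>a\<in>A. [:- a, 1:] * [:- a, 1:])"
proof -
  have "res_poly (lin a * lin a) = [:- a, 1:] * [:- a, 1:]" for a by (subst res_poly_mult) simp_all
  moreover have "lin a * lin a \<in> VX" for a by (intro VX_mult lin_VX)
  ultimately show ?thesis by (simp only: res_poly_prod)
qed

lemma res_poly_prod_lift: "I \<subseteq> irr \<Longrightarrow> res_poly (\<Prod>h\<in>I. lift h) = (\<Prod>h\<in>I. h)"
  by (subst res_poly_prod) (auto intro!: prod.cong)

lemma res_poly_substitution:
  assumes "\<And>k. S k \<in> VX" "\<Psi> \<in> VX" "c \<in> V"
  shows "res_poly (\<Sum>k<n. S k * smult (- c) \<Psi> ^ k)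
    = (\<Sum>k<n. smult (res c ^ k) (res_poly (S k) * (- res_poly \<Psi>) ^ k))"
proof -
  have c\<Psi>: "smult (- c) \<Psi> \<in> VX" using assms(2,3) by (intro VX_smult V_uminus)
  have "res_poly (smult (- c) \<Psi>) = smult (res c) (- res_poly \<Psi>)"
    using assms(2,3) by (simp only: res_poly_smult V_uminus res_uminus) simp
  then have eq: "res_poly (S k * smult (- c) \<Psi> ^ k) = smult (res c ^ k) (res_poly (S k) * (- res_poly \<Psi>) ^ k)" for k
    using assms(1)[of k] c\<Psi> by (simp only: res_poly_mult res_poly_power VX_power) (simp only: smult_power mult_smult_right)
  have "S k * smult (- c) \<Psi> ^ k \<in> VX" for k
    using assms(1) c\<Psi> by (intro VX_mult VX_power)
  then show ?thesis by (simp only: res_poly_sum eq)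
qed

text \<open>
  The sum obtained by the substitution is divisible by \<open>p\<close> modulo \<open>m\<close>. Reduction modulo \<open>p\<close>
  identifies \<open>m\<close> with \<open>quad e d\<close>, so that the modulus no longer depends on \<open>c\<close>, whereas the sum
  still does: its digits get weighted with the powers of the residue of \<open>c\<close>.
\<close>

lemma residue_dvd_of_substitution:
  assumes norm: "\<And>e d. e \<in> V \<Longrightarrow> d \<in> V \<Longrightarrow> quad_norm e d g \<in> V"
    and g: "smult (of_nat p ^ Suc N) g = (\<Sum>k<n. S k * smult (1 / of_nat p) Phi ^ k)"
    and S: "\<And>k. S k \<in> VX"
    and ed: "e \<in> V" "d \<in> V" "c \<in> V" and Phi: "Phi = quad e d * \<Psi>" "\<Psi> \<in> VX"
    and no_root: "\<And>s. s \<in> V \<Longrightarrow> poly (quad (e + of_nat p * c) d) s / of_nat p ^ 2 \<notin> V"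
  shows "res_poly (quad e d) dvd (\<Sum>k<n. smult (res c ^ k) (res_poly (S k) * (- res_poly \<Psi>) ^ k))"
proof -
  define W where "W = (\<Sum>k<n. S k * smult (- c) \<Psi> ^ k)"
  have W: "W \<in> VX"
    unfolding W_def using S Phi(2) ed by (intro VX_sum VX_mult VX_power VX_smult V_uminus)
  have ed': "e + of_nat p * c \<in> V" using ed by simp
  have "smult (1 / of_nat p) W \<in> adjoin (quad (e + of_nat p * c) d) X"
  proof (rule divisible_of_quad_norm[OF ed' ed(2) W])
    show "quad_norm (e + of_nat p * c) d W / of_nat p ^ 2 \<in> V"
      unfolding W_def by (rule norm_of_substitution[OF norm g ed Phi(1)])
  qed (rule no_root)
  moreover obtain q a b where q: "q \<in> VX" "W = quad (e + of_nat p * c) d * q + [:a, b:]"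
    using monic_quadratic_division[OF ed' ed(2) W] by blast
  have "W mod quad (e + of_nat p * c) d = [:a, b:]"
    by (rule mod_quad_eqI) (simp only: q(2) add_diff_cancel_right' dvd_triv_left)
  ultimately have ab: "smult (1 / of_nat p) [:a, b:] \<in> VX"
    unfolding adjoin_quad_X_iff mod_smult_left by simp
  then have "[:a, b:] \<in> VX" using VX_smult[OF V_of_nat[of p] ab] p_pos by simp
  then have "res_poly [:a, b:] = 0" using ab res_poly_eq_0_iff by blast
  moreover have "res_poly W = res_poly (quad (e + of_nat p * c) d) * res_poly q + res_poly [:a, b:]"
    unfolding q(2) using \<open>[:a, b:] \<in> VX\<close> q(1) ed' ed(2)
    by (simp only: res_poly_add res_poly_mult VX_mult VX_pCons V_1 VX_0 simp_thms)
  moreover have "res (of_nat p * c) = 0"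
    using ed(3) p_pos by (subst res_eq_0_iff) auto
  then have "res_poly (quad (e + of_nat p * c) d) = res_poly (quad e d)"
    using ed by (simp del: res_mult)
  ultimately have "res_poly W = res_poly (quad e d) * res_poly q" by (simp only: add_0_right)
  then have "res_poly (quad e d) dvd res_poly W" by (simp only: dvd_triv_left)
  then show ?thesis unfolding W_def res_poly_substitution[OF S Phi(2) ed(3)] .
qed

lemma card_residue_field: "CARD('p mod_ring) = p"
  using card_p by simp

definition cofactor_linear :: "'p mod_ring \<Rightarrow> rat poly" where
  "cofactor_linear a = (\<Prod>b\<in>UNIV - {a}. lin b * lin b) * theta_poly lift"

definition cofactor_irr :: "'p mod_ring poly \<Rightarrow> rat poly" where
  "cofactor_irr f = (\<Prod>a\<in>UNIV. lin a * lin a) * (\<Prod>h\<in>irr - {f}. lift h)"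

lemma cofactor_linear_VX: "cofactor_linear a \<in> VX"
  unfolding cofactor_linear_def by (intro VX_mult VX_prod theta_VX lin_VX)

lemma cofactor_irr_VX: "cofactor_irr f \<in> VX"
  unfolding cofactor_irr_def by (intro VX_mult VX_prod lin_VX) simp

lemma Phi_cofactor_linear: "Phi = quad (rep a * rep a) (- 2 * rep a) * cofactor_linear a"
proof -
  have "lin a * lin a = quad (rep a * rep a) (- 2 * rep a)" by simp
  then show ?thesis using Phi_split_double[of a] by (simp only: cofactor_linear_def)
qed

lemma res_poly_double_linear: "res_poly (quad (rep a * rep a) (- 2 * rep a)) = [:- a, 1:] ^ 2"
  by (simp add: power2_eq_square)

lemma coprime_cofactor_irr:
  assumes f: "f \<in> irr"
  shows "coprime f ((- res_poly (cofactor_irr f)) ^ k)"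
proof -
  have "(\<Prod>a\<in>UNIV. lin a * lin a) \<in> VX" by (intro VX_prod VX_mult lin_VX)
  moreover have "(\<Prod>h\<in>irr - {f}. lift h) \<in> VX" by (intro VX_prod) simp
  ultimately have "res_poly (cofactor_irr f) = (\<Prod>a\<in>UNIV. [:- a, 1:] * [:- a, 1:]) * (\<Prod>h\<in>irr - {f}. h)"
    by (simp only: cofactor_irr_def res_poly_mult res_poly_prod_double_linear res_poly_prod_lift[OF Diff_subset])
  moreover have "coprime f (\<Prod>a\<in>UNIV. [:- a, 1:] * [:- a, 1:])"
    by (intro prod_coprime_right) (simp only: coprime_mult_right_iff coprime_irr_linear[OF f] simp_thms)
  moreover have "coprime f (\<Prod>h\<in>irr - {f}. h)"
    by (intro prod_coprime_right coprime_irr[OF f]) auto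
  ultimately show ?thesis by (simp only: coprime_power_right_iff coprime_minus_right_iff coprime_mult_right_iff simp_thms)
qed

lemma coprime_cofactor_linear: "coprime ([:- a, 1:] ^ i) ((- res_poly (cofactor_linear a)) ^ k)"
proof -
  have "(\<Prod>b\<in>UNIV - {a}. lin b * lin b) \<in> VX" by (intro VX_prod VX_mult lin_VX)
  then have "res_poly (cofactor_linear a) = (\<Prod>b\<in>UNIV - {a}. [:- b, 1:] * [:- b, 1:]) * (\<Prod>h\<in>irr. h)"
    using theta_VX res_poly_prod_lift[OF subset_refl]
    by (simp only: cofactor_linear_def res_poly_mult res_poly_prod_double_linear theta_poly_def)
  moreover have "coprime [:- a, 1:] (\<Prod>b\<in>UNIV - {a}. [:- b, 1:] * [:- b, 1:])"
  proof (rule prod_coprime_right)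
    fix b assume "b \<in> UNIV - {a}"
    then have "coprime [:- a, 1:] [:- b, 1:]" by (intro coprime_linear) auto
    then show "coprime [:- a, 1:] ([:- b, 1:] * [:- b, 1:])" by (simp only: coprime_mult_right_iff simp_thms)
  qed
  moreover have "coprime [:- a, 1:] (\<Prod>h\<in>irr. h)"
    by (intro prod_coprime_right coprime_linear_irr)
  ultimately show ?thesis
    by (simp only: coprime_power_right_iff coprime_power_left_iff coprime_minus_right_iff
        coprime_mult_right_iff simp_thms)
qed

context
  fixes g :: "rat poly" and N :: nat and S :: "nat \<Rightarrow> rat poly"
  assumes norm: "\<And>e d. e \<in> V \<Longrightarrow> d \<in> V \<Longrightarrow> quad_norm e d g \<in> V"
    and g: "smult (of_nat p ^ Suc N) g = (\<Sum>k<p. S k * smult (1 / of_nat p) Phi ^ k)"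
    and S: "\<And>k. S k \<in> VX"
begin

text \<open>
  Here \<open>c\<close> may be any of the \<open>p\<close> residues, because an irreducible reduction excludes roots.
  Having as many residues as digits separates the digits.
\<close>

lemma irr_dvd_residue:
  assumes f: "f \<in> irr" and k: "k < p"
  shows "f dvd res_poly (S k)"
proof -
  define e d where "e = coeff (lift f) 0" and "d = coeff (lift f) 1"
  have ed: "e \<in> V" "d \<in> V" using f by (simp_all add: e_def d_def)
  have lift: "lift f = quad e d"
    using lift_props(3,5)[OF f]
    by (intro poly_eqI) (auto simp: e_def d_def coeff_pCons coeff_eq_0 numeral_2_eq_2 split: nat.splits)
  have res_poly_quad: "res_poly (quad e d) = f" using lift lift_props(2)[OF f] by (simp only:)
  have Phi: "Phi = quad e d * cofactor_irr f" using Phi_split_irr[OF f] by (simp only: cofactor_irr_def lift)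
  have comb: "f dvd (\<Sum>k<p. smult (c ^ k) (res_poly (S k) * (- res_poly (cofactor_irr f)) ^ k))" for c
  proof -
    have "poly (quad (e + of_nat p * rep c) d) s / of_nat p ^ 2 \<notin> V" if s: "s \<in> V" for s
    proof
      let ?m = "quad (e + of_nat p * rep c) d"
      assume "poly ?m s / of_nat p ^ 2 \<in> V"
      then have "of_nat p * (poly ?m s / of_nat p ^ 2) \<in> V" by (rule V_mult[OF V_of_nat])
      then have *: "poly ?m s / of_nat p \<in> V" using p_pos by (simp add: power2_eq_square)
      have "poly (quad e d) s / of_nat p = poly ?m s / of_nat p - rep c"
        using p_pos by (simp add: add_divide_distrib)
      also have "\<dots> \<in> V" by (rule V_diff[OF * rep_V])
      finally have "poly (quad e d) s / of_nat p \<in> V" .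
      moreover have quad: "quad e d \<in> VX" using ed by simp
      ultimately have "poly (res_poly (quad e d)) (res s) = 0"
        by (simp only: poly_res_poly[OF quad s] res_eq_0_iff[OF VX_poly[OF quad s]])
      then show False using irr_no_root[OF f, of "res s"] by (simp only: res_poly_quad)
    qed
    from residue_dvd_of_substitution[OF norm g S ed rep_V[of c] Phi cofactor_irr_VX this]
    show ?thesis by (simp only: res_poly_quad res_rep)
  qed
  have "f dvd res_poly (S k) * (- res_poly (cofactor_irr f)) ^ k"
    by (rule dvd_coefficients_of_vandermonde[where C = UNIV and n = p
          and u = "\<lambda>k. res_poly (S k) * (- res_poly (cofactor_irr f)) ^ k"])
      (simp_all only: finite order_refl card_residue_field k comb)
  then show ?thesis by (simp only: coprime_dvd_mult_left_iff[OF coprime_cofactor_irr[OF f]])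
qed

text \<open>
  The quadratic \<open>(x - a)\<^sup>2 + p c\<close> is an Eisenstein polynomial in \<open>x - a\<close> for \<open>c \<noteq> 0\<close> and has no
  root modulo \<open>p\<^sup>2\<close>.
\<close>

lemma double_linear_dvd_combination:
  assumes c: "c \<noteq> 0"
  shows "[:- a, 1:] ^ 2 dvd (\<Sum>k<p. smult (c ^ k) (res_poly (S k) * (- res_poly (cofactor_linear a)) ^ k))"
proof -
  have ed: "rep a * rep a \<in> V" "- 2 * rep a \<in> V" by (auto intro!: V_mult)
  have "poly (quad (rep a * rep a + of_nat p * rep c) (- 2 * rep a)) s / of_nat p ^ 2 \<notin> V" if s: "s \<in> V" for s
  proof
    let ?m = "quad (rep a * rep a + of_nat p * rep c) (- 2 * rep a)"
    assume *: "poly ?m s / of_nat p ^ 2 \<in> V"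
    have m: "poly ?m s = (s - rep a) ^ 2 + of_nat p * rep c"
      by (simp add: power2_eq_square algebra_simps)
    have pp: "of_nat p \<noteq> (0 :: rat)" using p_pos by simp
    have "(s - rep a) ^ 2 / of_nat p = of_nat p * (poly ?m s / of_nat p ^ 2) - rep c"
      unfolding m using pp by (simp add: add_divide_distrib power2_eq_square distrib_left)
    also have "\<dots> \<in> V" by (rule V_diff[OF V_mult[OF V_of_nat *] rep_V])
    finally have sp: "(s - rep a) / of_nat p \<in> V" using pV_power[of "s - rep a" 2] V_diff[OF s rep_V] by blast
    have "rep c / of_nat p = poly ?m s / of_nat p ^ 2 - ((s - rep a) / of_nat p) ^ 2"
      unfolding m using pp by (simp add: add_divide_distrib power2_eq_square)
    also have "\<dots> \<in> V" by (rule V_diff[OF * V_power[OF sp]])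
    finally have "res (rep c) = 0" by (subst res_eq_0_iff) simp_all
    then show False using c by simp
  qed
  from residue_dvd_of_substitution[OF norm g S ed rep_V[of c] Phi_cofactor_linear cofactor_linear_VX this]
  show ?thesis by (simp only: res_poly_double_linear res_rep)
qed

text \<open>
  For \<open>c = 0\<close> the modulus is \<open>(x - a)\<^sup>2\<close>, whose norm is the square of the value at \<open>a\<close>; this
  provides the \<open>p\<close>-th residue for the first power of \<open>x - a\<close>.
\<close>

lemma linear_dvd_residue_0: "[:- a, 1:] dvd res_poly (S 0)"
proof -
  define r where "r = rep a"
  have r: "r \<in> V" by (simp add: r_def)
  have ed: "rep a * rep a \<in> V" "- 2 * rep a \<in> V" by (auto intro!: V_mult)
  obtain w0 w1 where w: "quad (r * r) (- 2 * r) dvd S 0 - [:w0, w1:]" by (rule dvd_minus_mod_quad)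
  then obtain t where "S 0 - [:w0, w1:] = quad (r * r) (- 2 * r) * t" by (rule dvdE)
  then have "poly (S 0 - [:w0, w1:]) r = poly (quad (r * r) (- 2 * r)) r * poly t r" by (simp only: poly_mult)
  then have pr: "poly (S 0) r = w0 + r * w1" by (simp add: algebra_simps)
  have "quad_norm (r * r) (- 2 * r) (S 0) = poly (S 0) r ^ 2"
    unfolding quad_normI[OF w] pr by (simp add: power2_eq_square algebra_simps)
  moreover have "(\<Sum>k<p. S k * smult (- 0) (cofactor_linear a) ^ k) = S 0"
  proof -
    have "(\<Sum>k<p. S k * smult (- 0) (cofactor_linear a) ^ k) = (\<Sum>k<p. if k = 0 then S k else 0)"
      by (intro sum.cong) (auto simp: power_0_left)
    then show ?thesis using p_pos by (simp only: sum.delta finite_lessThan lessThan_iff if_True)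
  qed
  ultimately have *: "poly (S 0) r ^ 2 / of_nat p ^ 2 \<in> V"
    using norm_of_substitution[OF norm g ed V_0 Phi_cofactor_linear[of a]]
    by (simp only: r_def mult_zero_right add_0_right)
  have "of_nat p * (poly (S 0) r ^ 2 / of_nat p ^ 2) \<in> V" by (rule V_mult[OF V_of_nat *])
  then have "poly (S 0) r ^ 2 / of_nat p \<in> V" using p_pos by (simp add: power2_eq_square)
  then have "poly (S 0) r / of_nat p \<in> V"
    using pV_power[OF VX_poly[OF S r]] by blast
  then have "res (poly (S 0) r) = 0" using res_eq_0_iff[OF VX_poly[OF S r]] by blast
  then have "poly (res_poly (S 0)) a = 0" using poly_res_poly[OF S[of 0] r] by (simp add: r_def)
  then show ?thesis by (simp add: poly_eq_0_iff_dvd)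
qed

lemma linear_dvd_residue:
  assumes k: "k < p"
  shows "[:- a, 1:] dvd res_poly (S k)"
proof -
  have comb: "[:- a, 1:] dvd (\<Sum>k<p. smult (c ^ k) (res_poly (S k) * (- res_poly (cofactor_linear a)) ^ k))" for c
  proof (cases "c = 0")
    case True
    then have "(\<Sum>k<p. smult (c ^ k) (res_poly (S k) * (- res_poly (cofactor_linear a)) ^ k))
        = (\<Sum>k<p. if k = 0 then res_poly (S k) else 0)"
      by (intro sum.cong) (auto simp: power_0_left)
    also have "\<dots> = res_poly (S 0)"
      using p_pos by (simp only: sum.delta finite_lessThan lessThan_iff if_True)
    finally show ?thesis using linear_dvd_residue_0 by simp
  next
    case False
    show ?thesis
      by (rule dvd_mult_left[OF double_linear_dvd_combination[OF False, unfolded power2_eq_square]])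
  qed
  have "[:- a, 1:] dvd res_poly (S k) * (- res_poly (cofactor_linear a)) ^ k"
    by (rule dvd_coefficients_of_vandermonde[where C = UNIV and n = p
          and u = "\<lambda>k. res_poly (S k) * (- res_poly (cofactor_linear a)) ^ k"])
      (simp_all only: finite order_refl card_residue_field k comb)
  then show ?thesis
    by (simp only: coprime_dvd_mult_left_iff[OF coprime_cofactor_linear[of a 1 k, unfolded power_one_right]])
qed

text \<open>
  The squares of the linear polynomials divide a combination of the \<open>p\<close> digits for only \<open>p - 1\<close>
  values of \<open>c\<close>. The leading digit is therefore dealt with first: the simple divisors suffice
  for it because its degree is smaller by \<open>p\<close>. The remaining \<open>p - 1\<close> digits can then be
  separated.
\<close>

lemma residues_vanish:
  assumes deg: "\<And>k. k < p \<Longrightarrow> degree (S k) < degree Phi" "degree (S (p - 1)) < degree Phi - p"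
    and k: "k < p"
  shows "res_poly (S k) = 0"
proof -
  have deg_res_poly: "degree (res_poly f) \<le> degree f" for f
    by (rule degree_le) (simp add: coeff_eq_0)
  have top: "res_poly (S (p - 1)) = 0"
  proof (rule eq_0_of_divisors[where n = 1])
    show "degree (res_poly (S (p - 1))) < 1 * p + 2 * card irr"
      using deg(2) deg_res_poly[of "S (p - 1)"] by (simp add: Phi_degree)
    show "[:- a, 1:] ^ 1 dvd res_poly (S (p - 1))" for a
      using linear_dvd_residue[of "p - 1" a] p_pos by simp
    show "f dvd res_poly (S (p - 1))" if "f \<in> irr" for f
      using irr_dvd_residue[OF that, of "p - 1"] p_pos by simp
  qed
  show ?thesis
  proof (cases "k = p - 1")
    case True
    then show ?thesis using top by simp
  next
    case False
    then have kp: "k < p - 1" using k by simp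
    show ?thesis
    proof (rule eq_0_of_divisors[where n = 2])
      show "degree (res_poly (S k)) < 2 * p + 2 * card irr"
        using deg(1)[OF k] deg_res_poly[of "S k"] by (simp add: Phi_degree)
      show "f dvd res_poly (S k)" if "f \<in> irr" for f using irr_dvd_residue[OF that k] .
      fix a
      have comb: "[:- a, 1:] ^ 2 dvd (\<Sum>k<p - 1. smult (c ^ k) (res_poly (S k) * (- res_poly (cofactor_linear a)) ^ k))"
        if "c \<in> UNIV - {0}" for c
      proof -
        have "{..<p} = insert (p - 1) {..<p - 1}" using p_pos by auto
        then have "(\<Sum>k<p. smult (c ^ k) (res_poly (S k) * (- res_poly (cofactor_linear a)) ^ k))
            = (\<Sum>k<p - 1. smult (c ^ k) (res_poly (S k) * (- res_poly (cofactor_linear a)) ^ k))"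
          using top by (simp only: sum.insert finite_lessThan lessThan_iff less_irrefl not_False_eq_True
              mult_zero_left smult_0_right add_0_left)
        then show ?thesis using double_linear_dvd_combination[of c a] that by simp
      qed
      have "[:- a, 1:] ^ 2 dvd res_poly (S k) * (- res_poly (cofactor_linear a)) ^ k"
        by (rule dvd_coefficients_of_vandermonde[where C = "UNIV - {0}" and n = "p - 1"
              and u = "\<lambda>k. res_poly (S k) * (- res_poly (cofactor_linear a)) ^ k"])
          (simp_all only: card_nonzero order_refl finite finite_Diff kp comb)
      then show "[:- a, 1:] ^ 2 dvd res_poly (S k)"
        by (simp only: coprime_dvd_mult_left_iff[OF coprime_cofactor_linear[of a 2 k]])
    qed
  qed
qed

end

text \<open>
  Let \<open>N\<close> be such that \<open>p ^ (N + k) r k\<close> has coefficients in \<open>V\<close> for all digits \<open>r k\<close> of \<open>g\<close>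
  with respect to \<open>Phi\<close>. As long as \<open>N\<close> is positive, these polynomials are all divisible by \<open>p\<close>,
  so \<open>N\<close> can be lowered to \<open>0\<close>. Then \<open>g\<close> is a combination of powers of the integer-valued
  polynomial \<open>Phi / p\<close> over \<open>V[X]\<close>.
\<close>

lemma small_degree_imp_Int:
  assumes norm: "\<And>e d. e \<in> V \<Longrightarrow> d \<in> V \<Longrightarrow> quad_norm e d g \<in> V"
    and deg: "degree g < p * degree Phi - p"
  shows "g \<in> Int_M2 p"
proof -
  have "p < degree Phi" using p_pos by (simp add: Phi_degree)
  moreover have Suc_p: "Suc (p - 1) = p" using p_pos by simp
  ultimately obtain r where r: "g = (\<Sum>k<p. r k * Phi ^ k)" "\<forall>k<p. degree (r k) < degree Phi"
      "degree (r (p - 1)) < degree Phi - p"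
    using adic_expansion_top[of g "p - 1" Phi p] deg unfolding Suc_p by blast
  have pp: "of_nat p \<noteq> (0 :: rat)" using p_pos by simp
  define P where "P N \<longleftrightarrow> (\<forall>k<p. smult (of_nat p ^ (N + k)) (r k) \<in> VX)" for N
  have "\<exists>N. P N"
  proof -
    have "\<forall>k. \<exists>M. smult (of_nat p ^ M) (r k) \<in> VX"
      by (intro allI denominators_bounded_poly)
    from choice[OF this] obtain M where M: "\<And>k. smult (of_nat p ^ M k) (r k) \<in> VX" by blast
    have "smult (of_nat p ^ (sum M {..<p} + k)) (r k) \<in> VX" if "k < p" for k
    proof -
      have "M k \<le> sum M {..<p}" using that by (intro member_le_sum) auto
      then have "sum M {..<p} + k = (sum M {..<p} - M k + k) + M k" by simp
      then have "smult (of_nat p ^ (sum M {..<p} + k)) (r k)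
          = smult (of_nat p ^ (sum M {..<p} - M k + k)) (smult (of_nat p ^ M k) (r k))"
        by (simp only: power_add smult_smult)
      also have "\<dots> \<in> VX" by (rule VX_smult[OF _ M]) simp
      finally show ?thesis .
    qed
    then show ?thesis unfolding P_def by blast
  qed
  then obtain N where "P N" by blast
  have step: "P N" if PN: "P (Suc N)" for N
    unfolding P_def
  proof (intro allI impI)
    define S where "S k = (if k < p then smult (of_nat p ^ (Suc N + k)) (r k) else 0)" for k
    have S: "S k \<in> VX" for k using PN by (simp add: S_def P_def)
    have eq: "smult (of_nat p ^ Suc N) g = (\<Sum>k<p. S k * smult (1 / of_nat p) Phi ^ k)"
      unfolding r(1) smult_sum2
    proof (intro sum.cong refl)
      fix k assume "k \<in> {..<p}"
      then show "smult (of_nat p ^ Suc N) (r k * Phi ^ k) = S k * smult (1 / of_nat p) Phi ^ k"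
        using pp by (simp add: S_def smult_power power_add power_one_over)
    qed
    have degS: "degree (S k) < degree Phi" if "k < p" for k
      using r(2) pp that by (simp add: S_def)
    have deg_top: "degree (S (p - 1)) < degree Phi - p"
      using r(3) pp p_pos by (simp add: S_def)
    have vanish: "res_poly (S k) = 0" if "k < p" for k
      by (rule residues_vanish[OF norm eq S degS deg_top that])
    fix k assume k: "k < p"
    have "smult (1 / of_nat p) (S k) \<in> VX" using vanish[OF k] res_poly_eq_0_iff[OF S] by blast
    then show "smult (of_nat p ^ (N + k)) (r k) \<in> VX" using k pp by (simp add: S_def)
  qed
  have "P 0" using \<open>P N\<close> by (induction N) (auto intro: step)
  then have "smult (of_nat p ^ k) (r k) \<in> VX" if "k < p" for k
    using that by (simp add: P_def)
  then have "smult (of_nat p ^ k) (r k) * smult (1 / of_nat p) Phi ^ k \<in> Int_M2 p" if "k < p" for k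
    using that by (intro Int_M2_mult Int_M2_power Phi_over_p_in_Int VX_subset_Int_M2)
  then have "(\<Sum>k<p. smult (of_nat p ^ k) (r k) * smult (1 / of_nat p) Phi ^ k) \<in> Int_M2 p"
    by (intro Int_M2_sum) simp
  moreover have "smult (of_nat p ^ k) (r k) * smult (1 / of_nat p) Phi ^ k = r k * Phi ^ k" for k
    using pp by (simp add: smult_power power_one_over)
  ultimately show ?thesis by (simp only: r(1))
qed

lemma F_optimal: "optimal (Int_M2 p) F"
  unfolding optimal_def
proof (intro conjI allI impI)
  show "properly_integral (Int_M2 p) F"
    using F_integral F_notin_Int by (simp add: properly_integral_def)
  fix g assume g: "properly_integral (Int_M2 p) g"
  show "degree F \<le> degree g"
  proof (rule ccontr)
    assume "\<not> degree F \<le> degree g"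
    then have "g \<in> Int_M2 p"
      using g by (intro small_degree_imp_Int integral_imp_quad_norm_in_V)
        (simp_all add: F_degree properly_integral_def)
    then show False using g by (simp add: properly_integral_def)
  qed
qed

end

theorem corollary4p21:
  fixes p :: nat
    and \<pi> :: rat
    and rep :: "'p::prime_card mod_ring \<Rightarrow> rat"
    and lift :: "'p mod_ring poly \<Rightarrow> rat poly"
  assumes "prime p" and "CARD('p) = p"
    and "(\<lambda>x. \<pi> * x) ` Z_loc p = (\<lambda>x. of_nat p * x) ` Z_loc p"
    and "residue_representatives rep"
    and "monic_lifts lift"
  shows "optimal (Int_M2 p) (F_poly \<pi> rep lift)"
proof -
  interpret construction p \<pi> rep lift
    using assms by unfold_locales
  show ?thesis by (rule F_optimal)
qed

end
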